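(* Let $(I,\tilde g,V,\lambda,\mu)$ be an almost $\eta$-Ricci soliton with $\eta=dx^3$ and $V=\sum_{k=1}^3V^kE_k$. Suppose that $f_1,f_2$ depend only on $x^3$ and that $V^1,V^2,V^3$ depend only on $x^3$. Put $b=\frac{f_1'}{f_1}$ and $d=\frac{f_2'}{f_2}$. Then there are $c_1,c_2\in\mathbb R$ such that $$V^1=\frac{c_1}{f_1},\quad V^2=\frac{c_2}{f_2},\quad (b-d)V^3=(b-d)'-(b^2-d^2),\quad (b-d)\lambda=b'd-bd',$$ $$(b-d)^2\mu=-(b-d)\left[(b-d)''+b'd-bd'\right]+\left[(b-d)'\right]^2+(b-d)^2(b^2+d^2).$$ Moreover, the following hold (in each case $c_1,c_2$ denote some real constants). (i) On any open interval $J_3\subseteq I_3$ on which $\left(\frac{f_1}{f_2}\right)'\neq0$ everywhere (equivalently, $b\neq d$ everywhere on $J_3$), $$V^1=\frac{c_1}{f_1},\quad V^2=\frac{c_2}{f_2},\quad V^3=\frac{(b-d)'}{b-d}-(b+d),\quad \lambda=\frac{b'd-bd'}{b-d},$$ $$\mu=-\frac{(b-d)''+b'd-bd'}{b-d}+\left(\frac{(b-d)'}{b-d}\right)^2+b^2+d^2.$$ In particular: (1) if $f_1$ is constant on an open interval $J\subseteq J_3$ (whence $f_2'\neq0$ everywhere on $J$), then on $J$: $V^1=c_1$, $V^2=\frac{c_2}{f_2}$, $V^3=\frac{d'-d^2}{d}$, $\lambda=0$, $\mu=-\frac{d''}{d}+\left(\frac{d'}{d}\right)^2+d^2$; (2)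 if $f_2$ is constant on an open interval $J\subseteq J_3$ (whence $f_1'\neq0$ everywhere on $J$), then on $J$: $V^1=\frac{c_1}{f_1}$, $V^2=c_2$, $V^3=\frac{b'-b^2}{b}$, $\lambda=0$, $\mu=-\frac{b''}{b}+\left(\frac{b'}{b}\right)^2+b^2$. (ii) On any open interval $J_3\subseteq I_3$ on which $\frac{f_1}{f_2}$ is constant (equivalently, $b=d$ on $J_3$), $$V^1=\frac{c_1}{f_1},\quad V^2=\frac{c_2}{f_2},\quad bV^3=b'-2b^2+\lambda,\quad (V^3)'=-2(b'-b^2)-(\lambda+\mu).$$ In addition: (1) if $J\subseteq J_3$ is an open interval with $f_1'\neq0$ (and $f_2'\neq0$) everywhere on $J$, then on $J$: $V^1=\frac{c_1}{f_1}$, $V^2=\frac{c_2}{f_2}$, $V^3=\frac{b'-2b^2+\lambda}{b}$, $\lambda=-\left(\frac{b'+\lambda}{b}\right)'+2b^2-\mu$; (2) if $f_1$ and $f_2$ are constant on an open interval $J\subseteq J_3$, then on $J$: $V^1=c_1$, $V^2=c_2$, $V^3=F$, $\lambda=0$, where $F'=-\mu$.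
   Context: Let $I=I_1\times I_2\times I_3\subseteq\mathbb R^3$ with $I_1,I_2,I_3\subseteq\mathbb R$ open intervals and standard coordinates $x^1,x^2,x^3$. Let $f_1,f_2$ be smooth nowhere zero functions on $I$ and endow $I$ with the Riemannian metric $\tilde g=\frac{1}{f_1^2}dx^1\otimes dx^1+\frac{1}{f_2^2}dx^2\otimes dx^2+dx^3\otimes dx^3$. Let $E_1=f_1\frac{\partial}{\partial x^1}$, $E_2=f_2\frac{\partial}{\partial x^2}$, $E_3=\frac{\partial}{\partial x^3}$ (an orthonormal frame). For a smooth vector field $V$, a $1$-form $\eta$, and smooth functions $\lambda,\mu$ on $I$ with $\mu\neq0$ (not identically zero), $(I,\tilde g,V,\lambda,\mu)$ is an almost $\eta$-Ricci soliton if $\frac12\pounds_V\tilde g+\mathrm{Ric}+\lambda\tilde g+\mu\,\eta\otimes\eta=0$ on $I$, where $\pounds_V\tilde g$ is the Lie derivative of $\tilde g$ along $V$ and $\mathrm{Ric}$ is the Ricci tensor of $\tilde g$, with $\mathrm{Ric}(Y,Z)=\sum_{k}\tilde g(R(E_k,Y)Z,E_k)$, $R(X,Y)Z=\nabla_X\nabla_YZ-\nabla_Y\nabla_XZ-\nabla_{[X,Y]}Z$, $\nabla$ the Levi-Civita connection. Functions of $x^3$ alone are regarded as functions on $I_3$, and a prime denotes the derivative with respect to $x^3$ (under the hypotheses of the claim, all functions differentiated there depend only on $x^3$). *)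

theory Defs
  imports "HOL-Analysis.Analysis"
begin

section \<open>Smooth functions on open subsets of Euclidean space\<close>

definition dir_deriv :: "(real^'n \<Rightarrow> real^'n) \<Rightarrow> (real^'n \<Rightarrow> real) \<Rightarrow> real^'n \<Rightarrow> real" where
  "dir_deriv X h x = frechet_derivative h (at x) (X x)"

definition partial :: "'n \<Rightarrow> (real^'n \<Rightarrow> real) \<Rightarrow> real^'n \<Rightarrow> real" where
  "partial i h = dir_deriv (\<lambda>_. axis i 1) h"

primrec Ck_on :: "nat \<Rightarrow> (real^'n) set \<Rightarrow> (real^'n \<Rightarrow> real) \<Rightarrow> bool" where
  "Ck_on 0 S h \<longleftrightarrow> continuous_on S h"
| "Ck_on (Suc k) S h \<longleftrightarrow> (\<forall>x\<in>S. h differentiable (at x)) \<and> (\<forall>i. Ck_on k S (partial i h))"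

text \<open>All notions below are meant for an open set \<open>S\<close>; functions and vector fields on \<open>S\<close>
  are total functions whose values outside \<open>S\<close> are irrelevant.\<close>

definition smooth :: "(real^'n) set \<Rightarrow> (real^'n \<Rightarrow> real) \<Rightarrow> bool" where
  "smooth S h \<longleftrightarrow> (\<forall>k. Ck_on k S h)"


section \<open>Tensor fields, connections and curvature in a chart\<close>

text \<open>A vector field is given by its components in the coordinate frame.\<close>

definition smooth_vf :: "(real^'n) set \<Rightarrow> (real^'n \<Rightarrow> real^'n) \<Rightarrow> bool" where
  "smooth_vf S X \<longleftrightarrow> (\<forall>i. smooth S (\<lambda>x. X x $ i))"

definition one_form :: "(real^'n) set \<Rightarrow> (real^'n \<Rightarrow> real^'n \<Rightarrow> real) \<Rightarrow> bool" where
  "one_form S \<eta> \<longleftrightarrow> (\<forall>x\<in>S. linear (\<eta> x)) \<and> (\<forall>i. smooth S (\<lambda>x. \<eta> x (axis i 1)))"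

definition riemannian_metric ::
  "(real^'n) set \<Rightarrow> (real^'n \<Rightarrow> real^'n \<Rightarrow> real^'n \<Rightarrow> real) \<Rightarrow> bool" where
  "riemannian_metric S g \<longleftrightarrow>
     (\<forall>x\<in>S. bilinear (g x) \<and> (\<forall>u v. g x u v = g x v u) \<and> (\<forall>u. u \<noteq> 0 \<longrightarrow> g x u u > 0)) \<and>
     (\<forall>i j. smooth S (\<lambda>x. g x (axis i 1) (axis j 1)))"

definition lie_bracket ::
  "(real^'n \<Rightarrow> real^'n) \<Rightarrow> (real^'n \<Rightarrow> real^'n) \<Rightarrow> real^'n \<Rightarrow> real^'n" where
  "lie_bracket X Y x =
     (\<chi> k. dir_deriv X (\<lambda>y. Y y $ k) x - dir_deriv Y (\<lambda>y. X y $ k) x)"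

definition lie_deriv_metric ::
  "(real^'n \<Rightarrow> real^'n) \<Rightarrow> (real^'n \<Rightarrow> real^'n \<Rightarrow> real^'n \<Rightarrow> real) \<Rightarrow>
   (real^'n \<Rightarrow> real^'n) \<Rightarrow> (real^'n \<Rightarrow> real^'n) \<Rightarrow> real^'n \<Rightarrow> real" where
  "lie_deriv_metric V g Y Z x =
     dir_deriv V (\<lambda>y. g y (Y y) (Z y)) x
       - g x (lie_bracket V Y x) (Z x) - g x (Y x) (lie_bracket V Z x)"

definition affine_connection ::
  "(real^'n) set \<Rightarrow> ((real^'n \<Rightarrow> real^'n) \<Rightarrow> (real^'n \<Rightarrow> real^'n) \<Rightarrow> real^'n \<Rightarrow> real^'n) \<Rightarrow> bool" where
  "affine_connection S nabla \<longleftrightarrow>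
     (\<forall>X Y. smooth_vf S X \<longrightarrow> smooth_vf S Y \<longrightarrow> smooth_vf S (nabla X Y)) \<and>
     (\<forall>X Y Z. smooth_vf S X \<longrightarrow> smooth_vf S Y \<longrightarrow> smooth_vf S Z \<longrightarrow>
        (\<forall>x\<in>S. nabla (\<lambda>y. X y + Y y) Z x = nabla X Z x + nabla Y Z x \<and>
               nabla X (\<lambda>y. Y y + Z y) x = nabla X Y x + nabla X Z x)) \<and>
     (\<forall>h X Y. smooth S h \<longrightarrow> smooth_vf S X \<longrightarrow> smooth_vf S Y \<longrightarrow>
        (\<forall>x\<in>S. nabla (\<lambda>y. h y *\<^sub>R X y) Y x = h x *\<^sub>R nabla X Y x \<and>
               nabla X (\<lambda>y. h y *\<^sub>R Y y) x = dir_deriv X h x *\<^sub>R Y x + h x *\<^sub>R nabla X Y x))"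

definition levi_civita ::
  "(real^'n) set \<Rightarrow> (real^'n \<Rightarrow> real^'n \<Rightarrow> real^'n \<Rightarrow> real) \<Rightarrow>
   ((real^'n \<Rightarrow> real^'n) \<Rightarrow> (real^'n \<Rightarrow> real^'n) \<Rightarrow> real^'n \<Rightarrow> real^'n) \<Rightarrow> bool" where
  "levi_civita S g nabla \<longleftrightarrow>
     affine_connection S nabla \<and>
     (\<forall>X Y. smooth_vf S X \<longrightarrow> smooth_vf S Y \<longrightarrow>
        (\<forall>x\<in>S. nabla X Y x - nabla Y X x = lie_bracket X Y x)) \<and>
     (\<forall>X Y Z. smooth_vf S X \<longrightarrow> smooth_vf S Y \<longrightarrow> smooth_vf S Z \<longrightarrow>
        (\<forall>x\<in>S. dir_deriv X (\<lambda>y. g y (Y y) (Z y)) x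
               = g x (nabla X Y x) (Z x) + g x (Y x) (nabla X Z x)))"

definition curvature ::
  "((real^'n \<Rightarrow> real^'n) \<Rightarrow> (real^'n \<Rightarrow> real^'n) \<Rightarrow> real^'n \<Rightarrow> real^'n) \<Rightarrow>
   (real^'n \<Rightarrow> real^'n) \<Rightarrow> (real^'n \<Rightarrow> real^'n) \<Rightarrow> (real^'n \<Rightarrow> real^'n) \<Rightarrow> real^'n \<Rightarrow> real^'n" where
  "curvature nabla X Y Z x =
     nabla X (nabla Y Z) x - nabla Y (nabla X Z) x - nabla (lie_bracket X Y) Z x"

definition orthonormal_frame ::
  "(real^'n) set \<Rightarrow> (real^'n \<Rightarrow> real^'n \<Rightarrow> real^'n \<Rightarrow> real) \<Rightarrow> ('n \<Rightarrow> real^'n \<Rightarrow> real^'n) \<Rightarrow> bool" where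
  "orthonormal_frame S g E \<longleftrightarrow>
     (\<forall>k. smooth_vf S (E k)) \<and>
     (\<forall>x\<in>S. \<forall>i j. g x (E i x) (E j x) = (if i = j then 1 else 0))"

text \<open>The trace is taken in a \<open>g\<close>-orthonormal frame \<open>E\<close>; the result does not depend on it.\<close>

definition ricci ::
  "((real^'n \<Rightarrow> real^'n) \<Rightarrow> (real^'n \<Rightarrow> real^'n) \<Rightarrow> real^'n \<Rightarrow> real^'n) \<Rightarrow>
   (real^'n \<Rightarrow> real^'n \<Rightarrow> real^'n \<Rightarrow> real) \<Rightarrow> ('n \<Rightarrow> real^'n \<Rightarrow> real^'n) \<Rightarrow>
   (real^'n \<Rightarrow> real^'n) \<Rightarrow> (real^'n \<Rightarrow> real^'n) \<Rightarrow> real^'n \<Rightarrow> real" where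
  "ricci nabla g E Y Z x = (\<Sum>k\<in>UNIV. g x (curvature nabla (E k) Y Z x) (E k x))"

definition almost_eta_ricci_soliton ::
  "(real^'n) set \<Rightarrow> (real^'n \<Rightarrow> real^'n \<Rightarrow> real^'n \<Rightarrow> real) \<Rightarrow>
   ((real^'n \<Rightarrow> real^'n) \<Rightarrow> (real^'n \<Rightarrow> real^'n) \<Rightarrow> real^'n \<Rightarrow> real^'n) \<Rightarrow>
   ('n \<Rightarrow> real^'n \<Rightarrow> real^'n) \<Rightarrow> (real^'n \<Rightarrow> real^'n \<Rightarrow> real) \<Rightarrow>
   (real^'n \<Rightarrow> real^'n) \<Rightarrow> (real^'n \<Rightarrow> real) \<Rightarrow> (real^'n \<Rightarrow> real) \<Rightarrow> bool" where
  "almost_eta_ricci_soliton S g nabla E \<eta> V lam \<mu> \<longleftrightarrow>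
     open S \<and> riemannian_metric S g \<and> levi_civita S g nabla \<and> orthonormal_frame S g E \<and>
     one_form S \<eta> \<and> smooth_vf S V \<and> smooth S lam \<and> smooth S \<mu> \<and> (\<exists>x\<in>S. \<mu> x \<noteq> 0) \<and>
     (\<forall>Y Z. smooth_vf S Y \<longrightarrow> smooth_vf S Z \<longrightarrow>
        (\<forall>x\<in>S. lie_deriv_metric V g Y Z x / 2 + ricci nabla g E Y Z x
               + lam x * g x (Y x) (Z x) + \<mu> x * (\<eta> x (Y x) * \<eta> x (Z x)) = 0))"


section \<open>The warped metric on a box in three-space\<close>

definition open_interval :: "real set \<Rightarrow> bool" where
  "open_interval J \<longleftrightarrow> open J \<and> is_interval J"

definition box3 :: "real set \<Rightarrow> real set \<Rightarrow> real set \<Rightarrow> (real^3) set" where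
  "box3 A B C = {x. x $ 1 \<in> A \<and> x $ 2 \<in> B \<and> x $ 3 \<in> C}"

definition warped_metric ::
  "(real^3 \<Rightarrow> real) \<Rightarrow> (real^3 \<Rightarrow> real) \<Rightarrow> real^3 \<Rightarrow> real^3 \<Rightarrow> real^3 \<Rightarrow> real" where
  "warped_metric f1 f2 x u v =
     1 / (f1 x)\<^sup>2 * (u $ 1 * v $ 1) + 1 / (f2 x)\<^sup>2 * (u $ 2 * v $ 2) + u $ 3 * v $ 3"

definition warped_frame ::
  "(real^3 \<Rightarrow> real) \<Rightarrow> (real^3 \<Rightarrow> real) \<Rightarrow> 3 \<Rightarrow> real^3 \<Rightarrow> real^3" where
  "warped_frame f1 f2 k x =
     (if k = 1 then f1 x *\<^sub>R axis 1 1 else if k = 2 then f2 x *\<^sub>R axis 2 1 else axis 3 1)"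

definition dx3 :: "real^3 \<Rightarrow> real^3 \<Rightarrow> real" where
  "dx3 x v = v $ 3"

definition depends_only_on_x3 :: "(real^3) set \<Rightarrow> (real^3 \<Rightarrow> real) \<Rightarrow> bool" where
  "depends_only_on_x3 S h \<longleftrightarrow> (\<forall>x\<in>S. \<forall>y\<in>S. x $ 3 = y $ 3 \<longrightarrow> h x = h y)"

text \<open>A function of \<open>x $ 3\<close> alone is kept as a function on the box, so its derivative as a
  function of one variable is the partial derivative in the third coordinate.\<close>

abbreviation D3 :: "(real^3 \<Rightarrow> real) \<Rightarrow> real^3 \<Rightarrow> real" where
  "D3 \<equiv> partial 3"

lemma warped_metric_frame:
  assumes "f1 x \<noteq> 0" "f2 x \<noteq> 0"
  shows "warped_metric f1 f2 x (warped_frame f1 f2 i x) (warped_frame f1 f2 j x)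
           = (if i = j then 1 else 0)"
  using assms exhaust_3[of i] exhaust_3[of j]
  by (auto simp: warped_metric_def warped_frame_def axis_def power2_eq_square)

end

theory Submission
  imports Defs
begin

text \<open>
  In the frame the only nonzero brackets are \<open>[E\<^sub>3, E\<^sub>1] = b E\<^sub>1\<close> and \<open>[E\<^sub>3, E\<^sub>2] = d E\<^sub>2\<close>, so the Koszul
  formula gives \<open>\<nabla>\<^bsub>E\<^sub>i\<^esub> E\<^sub>j = \<beta>\<^sub>i (\<delta>\<^sub>i\<^sub>j E\<^sub>3 - \<delta>\<^sub>j\<^sub>3 E\<^sub>i)\<close> with \<open>\<beta> = (b, d, 0)\<close>. Evaluated on frame fields, the
  soliton equation becomes \<open>\<lambda> = b V\<^sup>3 - b' + b\<^sup>2 + b d = d V\<^sup>3 - d' + d\<^sup>2 + b d\<close> (diagonal entries 1, 2),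
  \<open>(V\<^sup>3)' + b' - b\<^sup>2 + d' - d\<^sup>2 + \<lambda> + \<mu> = 0\<close> (entry 33), and \<open>(f\<^sub>1 V\<^sup>1)' = (f\<^sub>2 V\<^sup>2)' = 0\<close> (entries 13, 23).
  Everything else follows by eliminating \<open>V\<^sup>3\<close> and \<open>(V\<^sup>3)'\<close>.
\<close>

section \<open>Calculus of directional derivatives\<close>

text \<open>Fields are total functions with irrelevant values outside the domain, so rewriting under
  a derivative is legitimate only for identities that hold on an open set around the point.\<close>

lemma has_derivative_cong_open:
  assumes "open S" "x \<in> S" "\<And>y. y \<in> S \<Longrightarrow> h y = k y"
  shows "(h has_derivative D) (at x) \<longleftrightarrow> (k has_derivative D) (at x)"
  using assms has_derivative_transform_within_open[of h D x UNIV S k]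
    has_derivative_transform_within_open[of k D x UNIV S h] by auto

lemma differentiable_cong_open:
  assumes "open S" "x \<in> S" "\<And>y. y \<in> S \<Longrightarrow> h y = k y"
  shows "h differentiable (at x) \<longleftrightarrow> k differentiable (at x)"
  using has_derivative_cong_open[OF assms] by (auto simp: differentiable_def)

lemma dir_deriv_cong_open:
  assumes "open S" "x \<in> S" "\<And>y. y \<in> S \<Longrightarrow> h y = k y" "X x = Y x"
  shows "dir_deriv X h x = dir_deriv Y k x"
  using has_derivative_cong_open[OF assms(1,2), of h k] assms(3,4)
  by (simp add: dir_deriv_def frechet_derivative_def)

lemma partial_cong_open:
  assumes "open S" "x \<in> S" "\<And>y. y \<in> S \<Longrightarrow> h y = k y"
  shows "partial i h x = partial i k x"
  unfolding partial_def by (rule dir_deriv_cong_open[OF assms]) auto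

lemma dir_deriv_eqI: "(h has_derivative D) (at x) \<Longrightarrow> dir_deriv X h x = D (X x)"
  unfolding dir_deriv_def using frechet_derivative_at[of h D x] by simp

lemma has_derivative_dir_deriv:
  "h differentiable (at x) \<Longrightarrow> (h has_derivative (\<lambda>v. dir_deriv (\<lambda>_. v) h x)) (at x)"
  unfolding dir_deriv_def frechet_derivative_works .

lemma dir_deriv_const: "dir_deriv X (\<lambda>y. c) x = 0"
  using dir_deriv_eqI[OF has_derivative_const[of c "at x"]] .

lemma dir_deriv_add:
  assumes "h differentiable (at x)" "k differentiable (at x)"
  shows "dir_deriv X (\<lambda>y. h y + k y) x = dir_deriv X h x + dir_deriv X k x"
  using dir_deriv_eqI[OF has_derivative_add[OF assms[THEN has_derivative_dir_deriv]]]
  by (simp add: dir_deriv_def)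

lemma dir_deriv_diff:
  assumes "h differentiable (at x)" "k differentiable (at x)"
  shows "dir_deriv X (\<lambda>y. h y - k y) x = dir_deriv X h x - dir_deriv X k x"
  using dir_deriv_eqI[OF has_derivative_diff[OF assms[THEN has_derivative_dir_deriv]]]
  by (simp add: dir_deriv_def)

lemma dir_deriv_mult:
  assumes "h differentiable (at x)" "k differentiable (at x)"
  shows "dir_deriv X (\<lambda>y. h y * k y) x = dir_deriv X h x * k x + h x * dir_deriv X k x"
  using dir_deriv_eqI[OF has_derivative_mult[OF assms[THEN has_derivative_dir_deriv]]]
  by (simp add: dir_deriv_def)

lemma dir_deriv_inverse:
  assumes "h differentiable (at x)" "h x \<noteq> 0"
  shows "dir_deriv X (\<lambda>y. inverse (h y)) x = - (dir_deriv X h x * (inverse (h x) * inverse (h x)))"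
  using dir_deriv_eqI[OF Deriv.has_derivative_inverse[OF assms(2) assms(1)[THEN has_derivative_dir_deriv]]]
  by (simp add: dir_deriv_def)

lemma dir_deriv_divide:
  assumes "h differentiable (at x)" "k differentiable (at x)" "k x \<noteq> 0"
  shows "dir_deriv X (\<lambda>y. h y / k y) x
           = (dir_deriv X h x * k x - h x * dir_deriv X k x) / (k x)\<^sup>2"
proof -
  have "(\<lambda>y. inverse (k y)) differentiable (at x)"
    using assms by (intro differentiable_inverse)
  then show ?thesis
    using dir_deriv_mult[OF assms(1), of "\<lambda>y. inverse (k y)" X] dir_deriv_inverse[OF assms(2,3), of X] assms(3)
    by (simp add: field_simps power2_eq_square)
qed

text \<open>Coordinate derivatives are directional derivatives along the constant field
  \<open>axis i 1\<close>, so all the rules specialise.\<close>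

lemmas partial_rules =
  dir_deriv_const[where X="\<lambda>_. axis i 1" for i, folded partial_def]
  dir_deriv_add[where X="\<lambda>_. axis i 1" for i, folded partial_def]
  dir_deriv_diff[where X="\<lambda>_. axis i 1" for i, folded partial_def]
  dir_deriv_mult[where X="\<lambda>_. axis i 1" for i, folded partial_def]
  dir_deriv_inverse[where X="\<lambda>_. axis i 1" for i, folded partial_def]
  dir_deriv_divide[where X="\<lambda>_. axis i 1" for i, folded partial_def]

lemma dir_deriv_eq_sum_partial:
  assumes "h differentiable (at x)"
  shows "dir_deriv X h x = (\<Sum>i\<in>UNIV. X x $ i * partial i h x)"
proof -
  have lin: "linear (frechet_derivative h (at x))"
    by (rule linear_frechet_derivative[OF assms])
  have "X x = (\<Sum>i\<in>UNIV. X x $ i *\<^sub>R axis i 1)"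
    using basis_expansion[of "X x"] by (simp add: scalar_mult_eq_scaleR)
  then have "dir_deriv X h x = frechet_derivative h (at x) (\<Sum>i\<in>UNIV. X x $ i *\<^sub>R axis i 1)"
    by (simp add: dir_deriv_def)
  then show ?thesis
    by (simp add: linear_sum[OF lin] linear_cmul[OF lin] partial_def dir_deriv_def)
qed

section \<open>Algebra of smooth functions\<close>

text \<open>Both functions are generalised in the induction, since its step passes to their partial
  derivatives, which agree on \<open>S\<close> by openness.\<close>

lemma Ck_on_cong:
  assumes "open S" "\<And>y. y \<in> S \<Longrightarrow> h y = k y"
  shows "Ck_on n S h \<longleftrightarrow> Ck_on n S k"
  using assms(2)
proof (induction n arbitrary: h k)
  case 0 then show ?case by (auto cong: continuous_on_cong)
next
  case (Suc n)
  have "Ck_on n S (partial i h) = Ck_on n S (partial i k)" for i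
    by (rule Suc.IH) (rule partial_cong_open[OF assms(1) _ Suc.prems])
  moreover have "h differentiable (at x) \<longleftrightarrow> k differentiable (at x)" if "x \<in> S" for x
    by (rule differentiable_cong_open[OF assms(1) that Suc.prems])
  ultimately show ?case by auto
qed

text \<open>The definition does not state this inclusion. Differentiability gives continuity at the
  bottom, and the step moves the loss of one order into the partial derivatives.\<close>

lemma Ck_on_Suc_imp: "Ck_on (Suc n) S h \<Longrightarrow> Ck_on n S h"
proof (induction n arbitrary: h)
  case 0 
  then show ?case
    by (auto intro!: continuous_at_imp_continuous_on differentiable_imp_continuous_within)
next
  case (Suc n)
  then show ?case by (metis Ck_on.simps(2))
qed

lemma Ck_on_const: "Ck_on n (S :: (real^'n) set) (\<lambda>x. c)"
proof (induction n arbitrary: c)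
  case (Suc n)
  have "partial i (\<lambda>x::real^'n. c) = (\<lambda>x. 0)" for i by (simp add: fun_eq_iff partial_rules)
  then show ?case using Suc by simp
qed simp

lemma Ck_on_add:
  assumes "open S" "Ck_on n S h" "Ck_on n S k"
  shows "Ck_on n S (\<lambda>x. h x + k x)"
  using assms(2,3)
proof (induction n arbitrary: h k)
  case 0 then show ?case by (auto intro: continuous_intros)
next
  case (Suc n)
  have "Ck_on n S (partial i (\<lambda>x. h x + k x))" for i
    using Suc
    by (subst Ck_on_cong[OF assms(1), of _ "\<lambda>x. partial i h x + partial i k x"])
       (auto simp: partial_rules)
  then show ?case using Suc.prems by auto
qed

text \<open>By the Leibniz rule each partial derivative is a sum of products; the undifferentiated
  factors are lowered by one order with \<open>Ck_on_Suc_imp\<close>.\<close>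

lemma Ck_on_mult:
  assumes "open S" "Ck_on n S h" "Ck_on n S k"
  shows "Ck_on n S (\<lambda>x. h x * k x)"
  using assms(2,3)
proof (induction n arbitrary: h k)
  case 0 then show ?case by (auto intro: continuous_intros)
next
  case (Suc n)
  have "Ck_on n S (partial i (\<lambda>x. h x * k x))" for i
  proof (subst Ck_on_cong[OF assms(1), of _ "\<lambda>x. partial i h x * k x + h x * partial i k x"])
    show "Ck_on n S (\<lambda>x. partial i h x * k x + h x * partial i k x)"
      using Suc.prems Suc.prems[THEN Ck_on_Suc_imp]
      by (intro Ck_on_add assms(1) Suc.IH) auto
  qed (use Suc.prems in \<open>auto simp: partial_rules\<close>)
  then show ?case using Suc.prems by auto
qed

lemma Ck_on_inverse:
  assumes "open S" "\<And>x. x \<in> S \<Longrightarrow> h x \<noteq> 0" "Ck_on n S h"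
  shows "Ck_on n S (\<lambda>x. inverse (h x))"
  using assms(3)
proof (induction n)
  case 0 then show ?case using assms(2) by (auto intro: continuous_intros)
next
  case (Suc n)
  have "Ck_on n S (partial i (\<lambda>x. inverse (h x)))" for i
  \<comment> \<open>The derivative contains \<open>inverse (h x)\<close> itself, which the induction
    hypothesis covers. The sign is a constant factor so that closure under products applies.\<close>
  proof (subst Ck_on_cong[OF assms(1),
        of _ "\<lambda>x. (- 1) * (partial i h x * (inverse (h x) * inverse (h x)))"])
    show "Ck_on n S (\<lambda>x. (- 1) * (partial i h x * (inverse (h x) * inverse (h x))))"
      using Suc.prems Suc.prems[THEN Ck_on_Suc_imp]
      by (intro Ck_on_mult assms(1) Suc.IH Ck_on_const) auto
  qed (use Suc.prems assms(2) in \<open>auto simp: partial_rules\<close>)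
  then show ?case using Suc.prems assms(2) by auto
qed

lemma smooth_differentiable: "smooth S h \<Longrightarrow> x \<in> S \<Longrightarrow> h differentiable (at x)"
  unfolding smooth_def using Ck_on.simps(2) by blast

lemma smooth_partial: "smooth S h \<Longrightarrow> smooth S (partial i h)"
  unfolding smooth_def using Ck_on.simps(2) by blast

lemma smooth_cong:
  "open S \<Longrightarrow> (\<And>y. y \<in> S \<Longrightarrow> h y = k y) \<Longrightarrow> smooth S h \<longleftrightarrow> smooth S k"
  unfolding smooth_def using Ck_on_cong[of S h k] by simp

lemma smooth_const: "smooth S (\<lambda>x. c)"
  by (simp add: smooth_def Ck_on_const)

lemma smooth_add: "open S \<Longrightarrow> smooth S h \<Longrightarrow> smooth S k \<Longrightarrow> smooth S (\<lambda>x. h x + k x)"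
  by (simp add: smooth_def Ck_on_add)

lemma smooth_mult: "open S \<Longrightarrow> smooth S h \<Longrightarrow> smooth S k \<Longrightarrow> smooth S (\<lambda>x. h x * k x)"
  by (simp add: smooth_def Ck_on_mult)

lemma smooth_divide:
  "open S \<Longrightarrow> smooth S h \<Longrightarrow> smooth S k \<Longrightarrow> (\<And>x. x \<in> S \<Longrightarrow> k x \<noteq> 0) \<Longrightarrow>
    smooth S (\<lambda>x. h x / k x)"
  by (simp add: smooth_def divide_inverse Ck_on_mult Ck_on_inverse)

lemma smooth_vf_scaleR:
  "open S \<Longrightarrow> smooth S h \<Longrightarrow> smooth_vf S X \<Longrightarrow> smooth_vf S (\<lambda>x. h x *\<^sub>R X x)"
  by (simp add: smooth_vf_def smooth_mult)

lemma smooth_vf_add: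
  "open S \<Longrightarrow> smooth_vf S X \<Longrightarrow> smooth_vf S Y \<Longrightarrow> smooth_vf S (\<lambda>x. X x + Y x)"
  by (simp add: smooth_vf_def smooth_add)

lemma smooth_vf_cong:
  assumes "open S" "\<And>y. y \<in> S \<Longrightarrow> X y = Y y"
  shows "smooth_vf S X \<longleftrightarrow> smooth_vf S Y"
  unfolding smooth_vf_def using assms by (intro all_cong1 smooth_cong) auto

section \<open>Koszul formula and locality of the Levi-Civita connection\<close>

lemma lie_bracket_cong_open:
  assumes "open S" "x \<in> S" "\<And>y. y \<in> S \<Longrightarrow> X y = X' y" "\<And>y. y \<in> S \<Longrightarrow> Y y = Y' y"
  shows "lie_bracket X Y x = lie_bracket X' Y' x"
  using assms unfolding lie_bracket_def by (auto intro!: arg_cong2[where f=minus] dir_deriv_cong_open)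

text \<open>Metric compatibility is added for two cyclic orders of the fields and subtracted for the
  third; vanishing torsion turns the remaining differences into brackets. The result serves both to
  compute the connection and to show that it is local.\<close>

lemma koszul:
  assumes "levi_civita S g nabla" "riemannian_metric S g"
    and "smooth_vf S X" "smooth_vf S Y" "smooth_vf S Z" "x \<in> S"
  shows "2 * g x (nabla X Y x) (Z x) =
    dir_deriv X (\<lambda>y. g y (Y y) (Z y)) x + dir_deriv Y (\<lambda>y. g y (Z y) (X y)) x
    - dir_deriv Z (\<lambda>y. g y (X y) (Y y)) x
    + g x (lie_bracket X Y x) (Z x) - g x (lie_bracket X Z x) (Y x) - g x (lie_bracket Y Z x) (X x)"
proof -
  have bil: "bilinear (g x)" and sym: "\<And>u v. g x u v = g x v u"
    using assms by (auto simp: riemannian_metric_def)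
  have comp: "dir_deriv X (\<lambda>y. g y (Y y) (Z y)) x = g x (nabla X Y x) (Z x) + g x (Y x) (nabla X Z x)"
    if "smooth_vf S X" "smooth_vf S Y" "smooth_vf S Z" for X Y Z
    using assms that by (simp add: levi_civita_def)
  have tor: "g x (lie_bracket X Y x) W = g x (nabla X Y x) W - g x (nabla Y X x) W"
    if "smooth_vf S X" "smooth_vf S Y" for X Y W
    using assms that bilinear_lsub[OF bil] by (metis levi_civita_def)
  show ?thesis
    using comp[of X Y Z] comp[of Y Z X] comp[of Z X Y] tor[of X Y "Z x"] tor[of X Z "Y x"]
      tor[of Y Z "X x"] sym[of "Y x" "nabla X Z x"] sym[of "Z x" "nabla Y X x"]
      sym[of "X x" "nabla Z Y x"] assms(3-5) by simp
qed

text \<open>The frame is a basis at \<open>x\<close>, so \<open>u - v\<close>, being orthogonal to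
  all frame vectors, is orthogonal to itself and vanishes by positivity.\<close>

lemma orthonormal_frame_eqI:
  fixes E :: "'n \<Rightarrow> real^'n \<Rightarrow> real^'n"
  assumes "riemannian_metric S g" "orthonormal_frame S g E" "x \<in> S"
    and "\<And>k. g x u (E k x) = g x v (E k x)"
  shows "u = v"
proof -
  have bil: "bilinear (g x)" and sym: "\<And>u v. g x u v = g x v u" 
    and pos: "\<And>u. u \<noteq> 0 \<Longrightarrow> g x u u > 0"
    using assms by (auto simp: riemannian_metric_def)
  have orth: "g x (E i x) (E j x) = (if i = j then 1 else 0)" for i j
    using assms by (auto simp: orthonormal_frame_def)
  have lin: "linear (g x w)" for w using bil by (simp add: bilinear_def)
  have inj: "inj (\<lambda>k. E k x)"
    by (metis injI orth zero_neq_one)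
  have ind: "independent (range (\<lambda>k. E k x))"
  proof (rule independent_if_scalars_zero)
    fix c v assume 0: "(\<Sum>v\<in>range (\<lambda>k. E k x). c v *\<^sub>R v) = 0" and "v \<in> range (\<lambda>k. E k x)"
    then obtain i where v: "v = E i x" by auto
    have "(\<Sum>k\<in>UNIV. c (E k x) *\<^sub>R E k x) = 0"
      using 0 inj by (simp add: sum.reindex)
    \<comment> \<open>Pairing with \<open>E i x\<close> isolates the coefficient of that
      vector.\<close>
    then have "g x (E i x) (\<Sum>k\<in>UNIV. c (E k x) *\<^sub>R E k x) = 0"
      by (simp add: linear_0[OF lin])
    then show "c v = 0"
      by (simp add: linear_sum[OF lin] linear_cmul[OF lin] orth v if_distrib cong: if_cong)
  qed simp
  \<comment> \<open>An independent set with as many elements as the dimension spans the whole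
    space.\<close>
  have "card (range (\<lambda>k. E k x)) = DIM(real^'n)"
    using inj by (simp add: card_image)
  then have span: "span (range (\<lambda>k. E k x)) = UNIV"
    using ind by (metis card_eq_dim dim_UNIV finite_imageI finite subset_UNIV top.extremum_uniqueI)
  have "linear (\<lambda>w. g x (u - v) w)" by (rule lin)
  moreover have "g x (u - v) w = 0" if "w \<in> range (\<lambda>k. E k x)" for w
    using that assms(4) bilinear_lsub[OF bil] by auto
  ultimately have "g x (u - v) (u - v) = 0"
    using linear_eq_0_on_span[of "g x (u - v)" "range (\<lambda>k. E k x)" "u - v"] span by auto
  then show ?thesis using pos[of "u - v"] by auto
qed

text \<open>Connections act here on total functions, so two fields that agree on \<open>S\<close> but not outside are
  different arguments; the right-hand side of the Koszul formula only sees their values on \<open>S\<close>.\<close>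

lemma levi_civita_local:
  assumes lc: "levi_civita S g nabla" and rm: "riemannian_metric S g" and "open S"
    and fr: "orthonormal_frame S g E" and x: "x \<in> S"
    and sm: "smooth_vf S X" "smooth_vf S Y" "smooth_vf S X'" "smooth_vf S Y'"
    and eq: "\<And>y. y \<in> S \<Longrightarrow> X y = X' y" "\<And>y. y \<in> S \<Longrightarrow> Y y = Y' y"
  shows "nabla X Y x = nabla X' Y' x"
proof (rule orthonormal_frame_eqI[OF rm fr x])
  fix k
  have E: "smooth_vf S (E k)" using fr by (simp add: orthonormal_frame_def)
  have "2 * g x (nabla X Y x) (E k x) = 2 * g x (nabla X' Y' x) (E k x)"
    unfolding koszul[OF lc rm sm(1,2) E x] koszul[OF lc rm sm(3,4) E x]
    using eq \<open>open S\<close> x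
    by (intro arg_cong2[where f=minus] arg_cong2[where f=plus] dir_deriv_cong_open
        arg_cong2[where f="g x"] lie_bracket_cong_open) auto
  then show "g x (nabla X Y x) (E k x) = g x (nabla X' Y' x) (E k x)" by simp
qed

section \<open>Functions of the third coordinate on a box\<close>

lemma depends_only_on_x3D:
  "depends_only_on_x3 S h \<Longrightarrow> x \<in> S \<Longrightarrow> y \<in> S \<Longrightarrow> x $ 3 = y $ 3 \<Longrightarrow> h x = h y"
  unfolding depends_only_on_x3_def by blast

lemma depends_only_on_x3_const: "depends_only_on_x3 S (\<lambda>_. c)"
  by (simp add: depends_only_on_x3_def)

text \<open>Chain rule along a coordinate line; it makes uniqueness of one-variable derivatives
  available.\<close>

lemma partial_eq_line_derivative:
  assumes "h differentiable (at x)"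
  shows "((\<lambda>t. h (x + t *\<^sub>R axis i 1)) has_real_derivative partial i h x) (at 0)"
proof -
  have "((\<lambda>t::real. x + t *\<^sub>R axis i 1) has_derivative (\<lambda>t. t *\<^sub>R axis i 1)) (at 0)"
    by (auto intro!: derivative_eq_intros)
  moreover have "(h has_derivative frechet_derivative h (at x)) (at (x + 0 *\<^sub>R axis i 1))"
    using assms by (simp add: frechet_derivative_works)
  ultimately have "((\<lambda>t. h (x + t *\<^sub>R axis i 1)) has_derivative
      (\<lambda>t. frechet_derivative h (at x) (t *\<^sub>R axis i 1))) (at 0)"
    by (rule has_derivative_compose)
  moreover have "(\<lambda>t. frechet_derivative h (at x) (t *\<^sub>R axis i 1)) = (*) (partial i h x)"
    by (auto simp: fun_eq_iff partial_def dir_deriv_def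
        linear_cmul[OF linear_frechet_derivative[OF assms]])
  ultimately show ?thesis by (simp add: has_field_derivative_def)
qed

lemma eventually_line_in_open:
  fixes x v :: "'a::real_normed_vector"
  assumes "open S" "x \<in> S"
  shows "\<forall>\<^sub>F t in nhds (0::real). x + t *\<^sub>R v \<in> S"
proof -
  have "((\<lambda>t::real. x + t *\<^sub>R v) \<longlongrightarrow> x + 0 *\<^sub>R v) (nhds 0)"
    by (intro tendsto_intros filterlim_ident)
  from topological_tendstoD[OF this assms(1)] show ?thesis using assms(2) by simp
qed

text \<open>Moving in direction \<open>i\<close> keeps the third coordinate, so \<open>h\<close> is
  constant on a short coordinate line through \<open>x\<close>.\<close>

lemma depends_only_on_x3_partial_eq_0:
  assumes "open S" "x \<in> S" "depends_only_on_x3 S h" "h differentiable (at x)" "i \<noteq> 3"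
  shows "partial i h x = 0"
proof -
  have "\<forall>\<^sub>F t in nhds 0. h (x + t *\<^sub>R axis i 1) = h x"
    using eventually_line_in_open[OF assms(1,2), of "axis i 1"]
    by eventually_elim (rule depends_only_on_x3D[OF assms(3)], use assms in \<open>simp_all add: axis_def\<close>)
  then have "((\<lambda>t. h x) has_real_derivative partial i h x) (at 0)"
    using DERIV_cong_ev[THEN iffD1, OF refl _ refl partial_eq_line_derivative[OF assms(4), of i]]
    by simp
  from DERIV_unique[OF this DERIV_const] show ?thesis .
qed

text \<open>The lines in direction 3 through \<open>x\<close> and \<open>y\<close> have the same
  third coordinate at each time, so \<open>h\<close> has the same restriction to both near time
  0.\<close>

lemma depends_only_on_x3_D3:
  assumes "open S" "depends_only_on_x3 S h" "\<And>x. x \<in> S \<Longrightarrow> h differentiable (at x)"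
  shows "depends_only_on_x3 S (D3 h)"
  unfolding depends_only_on_x3_def
proof (intro ballI impI)
  fix x y assume xy: "x \<in> S" "y \<in> S" "x $ 3 = y $ 3"
  have "\<forall>\<^sub>F t in nhds 0. h (x + t *\<^sub>R axis 3 1) = h (y + t *\<^sub>R axis 3 1)"
    using eventually_line_in_open[OF assms(1) xy(1), of "axis 3 1"]
      eventually_line_in_open[OF assms(1) xy(2), of "axis 3 1"]
    by eventually_elim (rule depends_only_on_x3D[OF assms(2)], use xy in simp_all)
  then have "((\<lambda>t. h (y + t *\<^sub>R axis 3 1)) has_real_derivative D3 h x) (at 0)"
    using DERIV_cong_ev[THEN iffD1, OF refl _ refl partial_eq_line_derivative[OF assms(3)[OF xy(1)], of 3]]
    by simp
  from DERIV_unique[OF this partial_eq_line_derivative[OF assms(3)[OF xy(2)]]]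
  show "D3 h x = D3 h y" .
qed

lemma constant_on_partial_eq_0:
  assumes "open T" "h constant_on T" "x \<in> T"
  shows "partial i h x = 0"
proof -
  obtain c where "\<forall>y\<in>T. h y = c" using assms(2) by (auto simp: constant_on_def)
  then have "partial i h x = partial i (\<lambda>_. c) x"
    by (intro partial_cong_open[OF assms(1,3)]) simp
  then show ?thesis by (simp add: partial_rules)
qed

lemma constant_on_if_partials_0:
  assumes "open S" "convex S" "\<And>x. x \<in> S \<Longrightarrow> h differentiable (at x)"
    and "\<And>x i. x \<in> S \<Longrightarrow> partial i h x = 0"
  shows "h constant_on S"
proof -
  have "(h has_derivative (\<lambda>v. 0)) (at x within S)" if "x \<in> S" for x
  proof -
    have "dir_deriv (\<lambda>_. v) h x = 0" for v
      using that assms(3,4) by (simp add: dir_deriv_eq_sum_partial)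
    then show ?thesis
      using has_derivative_dir_deriv[OF assms(3)[OF that]] by (simp add: has_derivative_at_withinI)
  qed
  then show ?thesis
    using has_derivative_zero_constant[OF assms(2)] unfolding constant_on_def by blast
qed

lemma open_box3: "open A \<Longrightarrow> open B \<Longrightarrow> open C \<Longrightarrow> open (box3 A B C)"
  using open_vector_box[of "\<lambda>i::3. if i = 1 then A else if i = 2 then B else C"]
  by (simp add: box3_def forall_3)

lemma convex_box3: "is_interval A \<Longrightarrow> is_interval B \<Longrightarrow> is_interval C \<Longrightarrow> convex (box3 A B C)"
  unfolding box3_def is_interval_convex_1 by (auto simp: convex_def)

lemma box3_mono: "C \<subseteq> D \<Longrightarrow> box3 A B C \<subseteq> box3 A B D"
  by (auto simp: box3_def)

lemma warped_metric_left:
  "warped_metric f1 f2 x (u + v) w = warped_metric f1 f2 x u w + warped_metric f1 f2 x v w"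
  "warped_metric f1 f2 x (u - v) w = warped_metric f1 f2 x u w - warped_metric f1 f2 x v w"
  "warped_metric f1 f2 x (c *\<^sub>R u) w = c * warped_metric f1 f2 x u w"
  by (simp_all add: warped_metric_def algebra_simps)

lemma warped_metric_sym: "warped_metric f1 f2 x u v = warped_metric f1 f2 x v u"
  by (simp add: warped_metric_def algebra_simps)

section \<open>Curvature and soliton equations in the frame\<close>

text \<open>Holds the hypotheses of the theorem except the names \<open>b\<close> and
  \<open>d\<close>, which become \<open>\<beta> 1\<close> and \<open>\<beta> 2\<close>.\<close>

locale warped_soliton =
  fixes I1 I2 I3 :: "real set"
    and f1 f2 lam \<mu> :: "real^3 \<Rightarrow> real"
    and Vc :: "3 \<Rightarrow> real^3 \<Rightarrow> real"
    and V :: "real^3 \<Rightarrow> real^3"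
    and nabla :: "(real^3 \<Rightarrow> real^3) \<Rightarrow> (real^3 \<Rightarrow> real^3) \<Rightarrow> real^3 \<Rightarrow> real^3"
  assumes intervals: "open_interval I1" "open_interval I2" "open_interval I3"
    and f_smooth: "smooth (box3 I1 I2 I3) f1" "smooth (box3 I1 I2 I3) f2"
    and f_nonzero: "\<forall>x\<in>box3 I1 I2 I3. f1 x \<noteq> 0 \<and> f2 x \<noteq> 0"
    and soliton: "almost_eta_ricci_soliton (box3 I1 I2 I3) (warped_metric f1 f2) nabla
                    (warped_frame f1 f2) dx3 V lam \<mu>"
    and V: "\<forall>x\<in>box3 I1 I2 I3. V x = (\<Sum>k\<in>UNIV. Vc k x *\<^sub>R warped_frame f1 f2 k x)"
    and f_x3: "depends_only_on_x3 (box3 I1 I2 I3) f1" "depends_only_on_x3 (box3 I1 I2 I3) f2"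
    and V_x3: "\<forall>k. depends_only_on_x3 (box3 I1 I2 I3) (Vc k)"
begin

section \<open>Frame coefficients and their logarithmic derivatives\<close>

abbreviation "S \<equiv> box3 I1 I2 I3"
abbreviation "g \<equiv> warped_metric f1 f2"
abbreviation "E \<equiv> warped_frame f1 f2"

text \<open>The frame is uniformly \<open>E k = a k \<partial>\<^sub>k\<close> with \<open>a 3 = 1\<close>, and \<open>\<beta> 1\<close>, \<open>\<beta> 2\<close> are
  \<open>b\<close>, \<open>d\<close>; with \<open>\<beta> 3 = 0\<close> all index cases of the structure equations coincide.\<close>

definition a :: "3 \<Rightarrow> real^3 \<Rightarrow> real" where
  "a k = (if k = 1 then f1 else if k = 2 then f2 else (\<lambda>_. 1))"

definition \<beta> :: "3 \<Rightarrow> real^3 \<Rightarrow> real" where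
  "\<beta> k x = D3 (a k) x / a k x"

lemma open_S: "open S" and convex_S: "convex S"
  using intervals by (auto simp: open_interval_def open_box3 convex_box3)

lemma nabla_levi_civita: "levi_civita S g nabla" and g_riemannian: "riemannian_metric S g"
  and frame: "orthonormal_frame S g E"
  using soliton by (auto simp: almost_eta_ricci_soliton_def)

lemma a_3 [simp]: "a 3 = (\<lambda>_. 1)"
  by (simp add: a_def)

lemma E_eq: "E k x = a k x *\<^sub>R axis k 1"
  using exhaust_3[of k] by (auto simp: warped_frame_def a_def)

lemma smooth_E: "smooth_vf S (E k)"
  using frame by (simp add: orthonormal_frame_def)

lemma smooth_a: "smooth S (a k)"
  using f_smooth smooth_const[of S 1] by (simp add: a_def)

lemma a_nonzero: "x \<in> S \<Longrightarrow> a k x \<noteq> 0"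
  using f_nonzero by (simp add: a_def)

lemma a_x3: "depends_only_on_x3 S (a k)"
  by (simp add: a_def f_x3 depends_only_on_x3_const)

lemma a_diff: "x \<in> S \<Longrightarrow> a k differentiable (at x)"
  by (rule smooth_differentiable[OF smooth_a])

lemma smooth_beta: "smooth S (\<beta> k)"
  unfolding \<beta>_def using open_S smooth_a a_nonzero by (intro smooth_divide smooth_partial) auto

lemma beta_diff: "x \<in> S \<Longrightarrow> \<beta> k differentiable (at x)"
  by (rule smooth_differentiable[OF smooth_beta])

lemma beta_x3: "depends_only_on_x3 S (\<beta> k)"
  using depends_only_on_x3D[OF depends_only_on_x3_D3[OF open_S a_x3 a_diff]]
    depends_only_on_x3D[OF a_x3]
  unfolding depends_only_on_x3_def \<beta>_def by (intro ballI impI arg_cong2[where f="(/)"]) blast+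

lemma beta_3 [simp]: "\<beta> 3 = (\<lambda>x. 0)"
  by (simp add: \<beta>_def a_def partial_rules fun_eq_iff)

text \<open>Index cases are encoded as \<open>of_bool\<close> factors, here and below, so that one
  formula serves all indices and simplifies once they are numerals.\<close>

lemma partial_a: "x \<in> S \<Longrightarrow> partial i (a k) x = of_bool (i = 3) * (\<beta> k x * a k x)"
  using depends_only_on_x3_partial_eq_0[OF open_S _ a_x3 a_diff] a_nonzero[of x k]
  by (simp add: \<beta>_def)

lemma partial_beta: "x \<in> S \<Longrightarrow> partial i (\<beta> k) x = of_bool (i = 3) * D3 (\<beta> k) x"
  using depends_only_on_x3_partial_eq_0[OF open_S _ beta_x3 beta_diff] by simp

lemma dir_deriv_E:
  assumes "h differentiable (at x)"
  shows "dir_deriv (E i) h x = a i x * partial i h x"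
  using linear_cmul[OF linear_frechet_derivative[OF assms]]
  by (simp add: dir_deriv_def partial_def E_eq)

text \<open>\<open>E 3\<close> is the plain coordinate field because \<open>a 3\<close> is 1. The
  factor \<open>c\<close> absorbs the signs and index conditions of the connection
  coefficients.\<close>

lemma dir_deriv_E_beta:
  "x \<in> S \<Longrightarrow> dir_deriv (E i) (\<lambda>y. c * \<beta> k y) x = of_bool (i = 3) * (c * D3 (\<beta> k) x)"
  using beta_diff[of x k] partial_beta[of x i k]
  by (simp add: dir_deriv_mult dir_deriv_const dir_deriv_E a_def)

lemma E_component: "(\<lambda>y. E j y $ k) = (if j = k then a j else (\<lambda>y. 0))"
  by (auto simp: E_eq axis_def fun_eq_iff)

lemma g_E: "x \<in> S \<Longrightarrow> g x (E i x) (E j x) = of_bool (i = j)"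
  using f_nonzero by (simp add: warped_metric_frame)

text \<open>Frame products are constant on \<open>S\<close>; this removes the derivative terms from
  the Koszul formula and from the Lie derivative of the metric.\<close>

lemma dir_deriv_g_E:
  assumes "x \<in> S"
  shows "dir_deriv X (\<lambda>y. g y (E i y) (E j y)) x = 0"
proof -
  have "dir_deriv X (\<lambda>y. g y (E i y) (E j y)) x = dir_deriv X (\<lambda>y. of_bool (i = j)) x"
    by (rule dir_deriv_cong_open[OF open_S assms]) (simp_all add: g_E)
  then show ?thesis by (simp add: dir_deriv_const)
qed

section \<open>Structure equations of the frame\<close>

lemma lie_bracket_E:
  assumes "x \<in> S"
  shows "lie_bracket (E i) (E j) x =
    (of_bool (i = 3) * \<beta> j x) *\<^sub>R E j x + (- (of_bool (j = 3) * \<beta> i x)) *\<^sub>R E i x"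
proof -
  have "dir_deriv (E i) (\<lambda>y. E j y $ k) x = of_bool (i = 3) * \<beta> j x * E j x $ k" for i j k
    using assms a_diff[OF assms] partial_a[OF assms]
    by (simp add: E_component dir_deriv_E partial_rules) (auto simp: E_eq axis_def)
  then show ?thesis by (simp add: lie_bracket_def vec_eq_iff)
qed

text \<open>Only the three bracket terms of the Koszul formula survive, and comparison with every
  \<open>E k\<close> determines the vector. For \<open>i = j = 3\<close> both sides vanish because
  \<open>\<beta> 3\<close> is 0.\<close>

lemma nabla_E:
  assumes x: "x \<in> S"
  shows "nabla (E i) (E j) x =
    (of_bool (i = j) * \<beta> i x) *\<^sub>R E 3 x + (- of_bool (j = 3) * \<beta> i x) *\<^sub>R E i x"
proof (rule orthonormal_frame_eqI[OF g_riemannian frame x])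
  fix k
  have "2 * g x (nabla (E i) (E j) x) (E k x) =
      2 * g x ((of_bool (i = j) * \<beta> i x) *\<^sub>R E 3 x + (- of_bool (j = 3) * \<beta> i x) *\<^sub>R E i x) (E k x)"
    unfolding koszul[OF nabla_levi_civita g_riemannian smooth_E smooth_E smooth_E x] dir_deriv_g_E[OF x] lie_bracket_E[OF x] 
      warped_metric_left g_E[OF x]
    by auto
  then show "g x (nabla (E i) (E j) x) (E k x) =
      g x ((of_bool (i = j) * \<beta> i x) *\<^sub>R E 3 x + (- of_bool (j = 3) * \<beta> i x) *\<^sub>R E i x) (E k x)"
    by simp
qed

text \<open>The common shape of the covariant derivatives and brackets of frame fields; its
  smoothness is what locality of the connection asks for.\<close>

lemma smooth_combination:
  "smooth_vf S (\<lambda>y. (c1 * \<beta> i y) *\<^sub>R E j y + (c2 * \<beta> k y) *\<^sub>R E l y)"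
  by (intro smooth_vf_add smooth_vf_scaleR smooth_mult open_S smooth_E smooth_beta smooth_const)

text \<open>Additivity and the Leibniz rule; the coefficients are differentiated along
  \<open>E k\<close>, which gives something only for \<open>k = 3\<close>.\<close>

lemma nabla_combination_right:
  assumes x: "x \<in> S"
  shows "nabla (E k) (\<lambda>y. (c1 * \<beta> i y) *\<^sub>R E j y + (c2 * \<beta> m y) *\<^sub>R E l y) x =
    (of_bool (k = 3) * (c1 * D3 (\<beta> i) x)) *\<^sub>R E j x + (c1 * \<beta> i x) *\<^sub>R nabla (E k) (E j) x
    + ((of_bool (k = 3) * (c2 * D3 (\<beta> m) x)) *\<^sub>R E l x + (c2 * \<beta> m x) *\<^sub>R nabla (E k) (E l) x)"
proof -
  have sm: "smooth S (\<lambda>y. c * \<beta> i y)" for c i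
    by (intro smooth_mult open_S smooth_const smooth_beta)
  have smE: "smooth_vf S (\<lambda>y. (c * \<beta> i y) *\<^sub>R E j y)" for c i j
    by (intro smooth_vf_scaleR sm open_S smooth_E)
  have ac: "affine_connection S nabla" using nabla_levi_civita by (simp add: levi_civita_def)
  have "nabla (E k) (\<lambda>y. (c1 * \<beta> i y) *\<^sub>R E j y + (c2 * \<beta> m y) *\<^sub>R E l y) x =
     nabla (E k) (\<lambda>y. (c1 * \<beta> i y) *\<^sub>R E j y) x + nabla (E k) (\<lambda>y. (c2 * \<beta> m y) *\<^sub>R E l y) x"
    using ac smE smooth_E x unfolding affine_connection_def by blast
  moreover have "nabla (E k) (\<lambda>y. (c * \<beta> i y) *\<^sub>R E j y) x =
      dir_deriv (E k) (\<lambda>y. c * \<beta> i y) x *\<^sub>R E j x + (c * \<beta> i x) *\<^sub>R nabla (E k) (E j) x" for c i j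
    using ac sm[of c i] smooth_E[of k] smooth_E[of j] x unfolding affine_connection_def by blast
  ultimately show ?thesis by (simp only: dir_deriv_E_beta[OF x])
qed

text \<open>The connection is linear over functions in its direction, so no derivatives of the
  coefficients appear.\<close>

lemma nabla_combination_left:
  assumes x: "x \<in> S"
  shows "nabla (\<lambda>y. (c1 * \<beta> i y) *\<^sub>R E j y + (c2 * \<beta> m y) *\<^sub>R E l y) (E k) x =
    (c1 * \<beta> i x) *\<^sub>R nabla (E j) (E k) x + (c2 * \<beta> m x) *\<^sub>R nabla (E l) (E k) x"
proof -
  have sm: "smooth S (\<lambda>y. c * \<beta> i y)" for c i
    by (intro smooth_mult open_S smooth_const smooth_beta)
  have smE: "smooth_vf S (\<lambda>y. (c * \<beta> i y) *\<^sub>R E j y)" for c i j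
    by (intro smooth_vf_scaleR sm open_S smooth_E)
  have ac: "affine_connection S nabla" using nabla_levi_civita by (simp add: levi_civita_def)
  have "nabla (\<lambda>y. (c1 * \<beta> i y) *\<^sub>R E j y + (c2 * \<beta> m y) *\<^sub>R E l y) (E k) x =
     nabla (\<lambda>y. (c1 * \<beta> i y) *\<^sub>R E j y) (E k) x + nabla (\<lambda>y. (c2 * \<beta> m y) *\<^sub>R E l y) (E k) x"
    using ac smE smooth_E x unfolding affine_connection_def by blast
  moreover have "nabla (\<lambda>y. (c * \<beta> i y) *\<^sub>R E j y) (E k) x = (c * \<beta> i x) *\<^sub>R nabla (E j) (E k) x"
    for c i j
    using ac sm[of c i] smooth_E[of k] smooth_E[of j] x unfolding affine_connection_def by blast
  ultimately show ?thesis by simp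
qed

section \<open>Curvature and Ricci tensor\<close>

text \<open>The structure equations hold only on \<open>S\<close>, so substituting them inside an
  outer \<open>nabla\<close> relies on \<open>levi_civita_local\<close>.\<close>

lemma curvature_E:
  assumes x: "x \<in> S"
  shows "curvature nabla (E k) (E i) (E j) x =
    nabla (E k) (\<lambda>y. (of_bool (i = j) * \<beta> i y) *\<^sub>R E 3 y + (- of_bool (j = 3) * \<beta> i y) *\<^sub>R E i y) x
    - nabla (E i) (\<lambda>y. (of_bool (k = j) * \<beta> k y) *\<^sub>R E 3 y + (- of_bool (j = 3) * \<beta> k y) *\<^sub>R E k y) x
    - nabla (\<lambda>y. (of_bool (k = 3) * \<beta> i y) *\<^sub>R E i y + (- of_bool (i = 3) * \<beta> k y) *\<^sub>R E k y) (E j) x"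
proof -
  have "smooth_vf S (nabla (E i) (E j))" for i j
    using nabla_levi_civita smooth_E by (simp add: levi_civita_def affine_connection_def)
  then have "nabla (E k) (nabla (E i) (E j)) x =
     nabla (E k) (\<lambda>y. (of_bool (i = j) * \<beta> i y) *\<^sub>R E 3 y + (- of_bool (j = 3) * \<beta> i y) *\<^sub>R E i y) x" for k i
    by (intro levi_civita_local[OF nabla_levi_civita g_riemannian open_S frame x smooth_E _ smooth_E smooth_combination])
       (simp_all add: nabla_E)
  moreover have "nabla (lie_bracket (E k) (E i)) (E j) x =
    nabla (\<lambda>y. (of_bool (k = 3) * \<beta> i y) *\<^sub>R E i y + (- of_bool (i = 3) * \<beta> k y) *\<^sub>R E k y) (E j) x"
  proof (intro levi_civita_local[OF nabla_levi_civita g_riemannian open_S frame x _ smooth_E smooth_combination smooth_E])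
    show "smooth_vf S (lie_bracket (E k) (E i))"
      using smooth_combination[of "of_bool (k = 3)" i i "- of_bool (i = 3)" k k]
      by (subst smooth_vf_cong[OF open_S lie_bracket_E]) simp_all
  qed (simp_all add: lie_bracket_E)
  ultimately show ?thesis by (simp add: curvature_def)
qed

text \<open>Diagonal entries are sums of sectional curvatures:
  \<open>D3 (\<beta> k) x - (\<beta> k x)\<^sup>2\<close> for the plane of \<open>E k\<close> and
  \<open>E 3\<close> with \<open>k\<close> equal to 1 or 2, and
  \<open>- \<beta> 1 x * \<beta> 2 x\<close> for the plane of \<open>E 1\<close> and
  \<open>E 2\<close>.\<close>

lemma ricci_E:
  assumes x: "x \<in> S"
  shows "ricci nabla g E (E 1) (E 1) x = D3 (\<beta> 1) x - (\<beta> 1 x)\<^sup>2 - \<beta> 1 x * \<beta> 2 x"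
    and "ricci nabla g E (E 2) (E 2) x = D3 (\<beta> 2) x - (\<beta> 2 x)\<^sup>2 - \<beta> 1 x * \<beta> 2 x"
    and "ricci nabla g E (E 3) (E 3) x = D3 (\<beta> 1) x - (\<beta> 1 x)\<^sup>2 + D3 (\<beta> 2) x - (\<beta> 2 x)\<^sup>2"
    and "ricci nabla g E (E 1) (E 3) x = 0"
    and "ricci nabla g E (E 2) (E 3) x = 0"
  unfolding ricci_def sum_3 curvature_E[OF x] nabla_combination_left[OF x]
    nabla_combination_right[OF x] nabla_E[OF x] warped_metric_left g_E[OF x]
  by (simp_all add: power2_eq_square partial_rules)

section \<open>Lie derivative of the metric along \<open>V\<close>\<close>

lemma V_component: "x \<in> S \<Longrightarrow> V x $ k = Vc k x * a k x"
  using V exhaust_3[of k] by (auto simp: E_eq axis_def sum_3)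

text \<open>Smoothness is given for \<open>V\<close> in coordinates; the frame components follow on
  division by the nonvanishing \<open>a k\<close>.\<close>

lemma smooth_Vc: "smooth S (Vc k)"
proof -
  have "smooth S (\<lambda>x. V x $ k / a k x)"
    using soliton a_nonzero
    by (intro smooth_divide open_S smooth_a) (auto simp: almost_eta_ricci_soliton_def smooth_vf_def)
  then show ?thesis
    by (subst smooth_cong[OF open_S, of _ "\<lambda>x. V x $ k / a k x"]) (simp_all add: V_component a_nonzero)
qed

lemma Vc_diff: "x \<in> S \<Longrightarrow> Vc k differentiable (at x)"
  by (rule smooth_differentiable[OF smooth_Vc])

text \<open>\<open>V\<close> differentiates frame coefficients only through its third component
  \<open>Vc 3\<close>, and \<open>E i\<close> differentiates the components of \<open>V\<close> only
  for \<open>i = 3\<close>.\<close>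

lemma lie_bracket_V_E:
  assumes x: "x \<in> S"
  shows "lie_bracket V (E i) x $ k =
     Vc 3 x * \<beta> i x * E i x $ k - of_bool (i = 3) * (D3 (Vc k) x + Vc k x * \<beta> k x) * a k x"
proof -
  have "dir_deriv V (\<lambda>y. E i y $ k) x = Vc 3 x * \<beta> i x * E i x $ k"
    using a_diff[OF x] V_component[OF x, of 3]
    by (simp add: E_component dir_deriv_eq_sum_partial partial_a[OF x] sum_3 partial_rules)
       (simp add: E_eq axis_def)
  moreover have "dir_deriv (E i) (\<lambda>y. V y $ k) x = dir_deriv (E i) (\<lambda>y. Vc k y * a k y) x"
    by (rule dir_deriv_cong_open[OF open_S x V_component]) auto
  moreover have "dir_deriv (E i) (\<lambda>y. Vc k y * a k y) x =
      of_bool (i = 3) * (D3 (Vc k) x + Vc k x * \<beta> k x) * a k x"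
    using depends_only_on_x3_partial_eq_0[OF open_S x V_x3[rule_format] Vc_diff[OF x], of i k]
    by (simp add: dir_deriv_mult dir_deriv_E a_diff[OF x] Vc_diff[OF x] partial_a[OF x] algebra_simps)
  ultimately show ?thesis by (simp add: lie_bracket_def)
qed

lemma lie_bracket_V_E_vec:
  assumes x: "x \<in> S"
  shows "lie_bracket V (E i) x = (Vc 3 x * \<beta> i x) *\<^sub>R E i x
     - of_bool (i = 3) *\<^sub>R ((D3 (Vc 1) x + Vc 1 x * \<beta> 1 x) *\<^sub>R E 1 x
        + (D3 (Vc 2) x + Vc 2 x * \<beta> 2 x) *\<^sub>R E 2 x + D3 (Vc 3) x *\<^sub>R E 3 x)"
  by (simp add: vec_eq_iff lie_bracket_V_E[OF x] forall_3) (simp add: E_eq axis_def)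

text \<open>Since frame products are constant, only the two bracket terms contribute.\<close>

lemma lie_deriv_E:
  assumes x: "x \<in> S"
  shows "lie_deriv_metric V g (E 1) (E 1) x = - 2 * (Vc 3 x * \<beta> 1 x)"
    and "lie_deriv_metric V g (E 2) (E 2) x = - 2 * (Vc 3 x * \<beta> 2 x)"
    and "lie_deriv_metric V g (E 3) (E 3) x = 2 * D3 (Vc 3) x"
    and "lie_deriv_metric V g (E 1) (E 3) x = D3 (Vc 1) x + Vc 1 x * \<beta> 1 x"
    and "lie_deriv_metric V g (E 2) (E 3) x = D3 (Vc 2) x + Vc 2 x * \<beta> 2 x"
proof -
  have "lie_deriv_metric V g (E i) (E j) x = - g x (lie_bracket V (E i) x) (E j x)
      - g x (lie_bracket V (E j) x) (E i x)" for i j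
    unfolding lie_deriv_metric_def dir_deriv_g_E[OF x] warped_metric_sym[of f1 f2 x "E i x"] by simp
  note * = this lie_bracket_V_E_vec[OF x] warped_metric_left g_E[OF x]
  show "lie_deriv_metric V g (E 1) (E 1) x = - 2 * (Vc 3 x * \<beta> 1 x)"
    and "lie_deriv_metric V g (E 2) (E 2) x = - 2 * (Vc 3 x * \<beta> 2 x)"
    and "lie_deriv_metric V g (E 3) (E 3) x = 2 * D3 (Vc 3) x"
    and "lie_deriv_metric V g (E 1) (E 3) x = D3 (Vc 1) x + Vc 1 x * \<beta> 1 x"
    and "lie_deriv_metric V g (E 2) (E 3) x = D3 (Vc 2) x + Vc 2 x * \<beta> 2 x"
    unfolding * by simp_all
qed

section \<open>Scalar equations and their consequences\<close>

lemma soliton_equations: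
  assumes x: "x \<in> S"
  shows "lam x = Vc 3 x * \<beta> 1 x - D3 (\<beta> 1) x + (\<beta> 1 x)\<^sup>2 + \<beta> 1 x * \<beta> 2 x"
    and "lam x = Vc 3 x * \<beta> 2 x - D3 (\<beta> 2) x + (\<beta> 2 x)\<^sup>2 + \<beta> 1 x * \<beta> 2 x"
    and "D3 (Vc 3) x = - (D3 (\<beta> 1) x - (\<beta> 1 x)\<^sup>2 + D3 (\<beta> 2) x - (\<beta> 2 x)\<^sup>2) - lam x - \<mu> x"
    and "D3 (Vc 1) x + Vc 1 x * \<beta> 1 x = 0"
    and "D3 (Vc 2) x + Vc 2 x * \<beta> 2 x = 0"
proof -
  \<comment> \<open>On frame fields the metric becomes the Kronecker symbol, and the square of
    \<open>dx3\<close> is 1 at the entry (3,3) and 0 elsewhere.\<close>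
  have "lie_deriv_metric V g (E i) (E j) x / 2 + ricci nabla g E (E i) (E j) x
          + lam x * of_bool (i = j) + \<mu> x * (of_bool (i = 3) * of_bool (j = 3)) = 0" for i j
  proof -
    have "dx3 x (E i x) = of_bool (i = 3)" for i
      by (simp add: dx3_def E_eq axis_def a_def)
    moreover have "lie_deriv_metric V g (E i) (E j) x / 2 + ricci nabla g E (E i) (E j) x
               + lam x * g x (E i x) (E j x) + \<mu> x * (dx3 x (E i x) * dx3 x (E j x)) = 0"
      using soliton smooth_E x unfolding almost_eta_ricci_soliton_def by blast
    ultimately show ?thesis using g_E[OF x] by simp
  qed
  from this[of 1 1] this[of 2 2] this[of 3 3] this[of 1 3] this[of 2 3] lie_deriv_E[OF x] ricci_E[OF x]
  show "lam x = Vc 3 x * \<beta> 1 x - D3 (\<beta> 1) x + (\<beta> 1 x)\<^sup>2 + \<beta> 1 x * \<beta> 2 x"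
    and "lam x = Vc 3 x * \<beta> 2 x - D3 (\<beta> 2) x + (\<beta> 2 x)\<^sup>2 + \<beta> 1 x * \<beta> 2 x"
    and "D3 (Vc 3) x = - (D3 (\<beta> 1) x - (\<beta> 1 x)\<^sup>2 + D3 (\<beta> 2) x - (\<beta> 2 x)\<^sup>2) - lam x - \<mu> x"
    and "D3 (Vc 1) x + Vc 1 x * \<beta> 1 x = 0"
    and "D3 (Vc 2) x + Vc 2 x * \<beta> 2 x = 0"
    by simp_all
qed

text \<open>Entries (1,3) and (2,3) say that \<open>Vc k * a k\<close> has zero third derivative.
  Its other partial derivatives vanish as well, so it is constant on the convex box.\<close>

lemma V_constants:
  assumes "k \<noteq> 3"
  shows "\<exists>c. \<forall>x\<in>S. Vc k x = c / a k x"
proof -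
  have "partial i (\<lambda>y. Vc k y * a k y) x = 0" if x: "x \<in> S" for x i
  proof -
    have "D3 (Vc k) x = - (Vc k x * \<beta> k x)"
      using soliton_equations(4,5)[OF x] assms exhaust_3[of k] by auto
    moreover have "i \<noteq> 3 \<Longrightarrow> partial i (Vc k) x = 0"
      using depends_only_on_x3_partial_eq_0[OF open_S x V_x3[rule_format] Vc_diff[OF x]] .
    ultimately show ?thesis
      using x by (cases "i = 3") (simp_all add: partial_rules Vc_diff a_diff partial_a)
  qed
  moreover have "(\<lambda>y. Vc k y * a k y) differentiable (at x)" if "x \<in> S" for x
    using that by (simp add: differentiable_mult Vc_diff a_diff)
  ultimately obtain c where "\<forall>x\<in>S. Vc k x * a k x = c"
    using constant_on_if_partials_0[OF open_S convex_S] unfolding constant_on_def by blast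
  then have "\<forall>x\<in>S. Vc k x = c / a k x"
    using a_nonzero by (metis nonzero_eq_divide_eq)
  then show ?thesis ..
qed

lemma D3_beta_diff:
  assumes x: "x \<in> S"
  shows "D3 (\<lambda>y. \<beta> 1 y - \<beta> 2 y) x = D3 (\<beta> 1) x - D3 (\<beta> 2) x"
    and "D3 (D3 (\<lambda>y. \<beta> 1 y - \<beta> 2 y)) x = D3 (D3 (\<beta> 1)) x - D3 (D3 (\<beta> 2)) x"
proof -
  \<comment> \<open>The first-order rule is proved on all of \<open>S\<close> because it is
    differentiated once more.\<close>
  have *: "D3 (\<lambda>y. \<beta> 1 y - \<beta> 2 y) x = D3 (\<beta> 1) x - D3 (\<beta> 2) x" if "x \<in> S" for x
    using that by (simp add: partial_rules beta_diff)
  then show "D3 (\<lambda>y. \<beta> 1 y - \<beta> 2 y) x = D3 (\<beta> 1) x - D3 (\<beta> 2) x" using x .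
  have "D3 (D3 (\<lambda>y. \<beta> 1 y - \<beta> 2 y)) x = D3 (\<lambda>y. D3 (\<beta> 1) y - D3 (\<beta> 2) y) x"
    by (rule partial_cong_open[OF open_S x *])
  also have "\<dots> = D3 (D3 (\<beta> 1)) x - D3 (D3 (\<beta> 2)) x"
    using x by (simp add: partial_rules smooth_differentiable[OF smooth_partial[OF smooth_beta]])
  finally show "D3 (D3 (\<lambda>y. \<beta> 1 y - \<beta> 2 y)) x = D3 (D3 (\<beta> 1)) x - D3 (D3 (\<beta> 2)) x" .
qed

text \<open>The difference of the two expressions for \<open>lam\<close>.\<close>

lemma V3_equation:
  assumes x: "x \<in> S"
  shows "(\<beta> 1 x - \<beta> 2 x) * Vc 3 x = D3 (\<lambda>y. \<beta> 1 y - \<beta> 2 y) x - ((\<beta> 1 x)\<^sup>2 - (\<beta> 2 x)\<^sup>2)"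
  using soliton_equations(1,2)[OF x] by (simp add: D3_beta_diff[OF x] algebra_simps)

text \<open>Multiplying the first expression for \<open>lam\<close> by \<open>\<beta> 2 x\<close>,
  the second by \<open>\<beta> 1 x\<close> and subtracting cancels \<open>Vc 3 x\<close>.\<close>

lemma lam_equation:
  assumes x: "x \<in> S"
  shows "(\<beta> 1 x - \<beta> 2 x) * lam x = D3 (\<beta> 1) x * \<beta> 2 x - \<beta> 1 x * D3 (\<beta> 2) x"
  using soliton_equations(1,2)[OF x] by algebra

lemma V3_equation_derivative:
  assumes x: "x \<in> S"
  shows "(D3 (\<beta> 1) x - D3 (\<beta> 2) x) * Vc 3 x + (\<beta> 1 x - \<beta> 2 x) * D3 (Vc 3) x
    = D3 (D3 (\<beta> 1)) x - D3 (D3 (\<beta> 2)) x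
      - 2 * (\<beta> 1 x * D3 (\<beta> 1) x - \<beta> 2 x * D3 (\<beta> 2) x)"
proof -
  note diff = beta_diff[OF x] Vc_diff[OF x]
    smooth_differentiable[OF smooth_partial[OF smooth_beta] x]
  \<comment> \<open>\<open>V3_equation\<close> holds on the open set \<open>S\<close> and may be
    differentiated; squares are written as products to suit the product rule.\<close>
  have "D3 (\<lambda>y. (\<beta> 1 y - \<beta> 2 y) * Vc 3 y) x
      = D3 (\<lambda>y. (D3 (\<beta> 1) y - D3 (\<beta> 2) y) - (\<beta> 1 y * \<beta> 1 y - \<beta> 2 y * \<beta> 2 y)) x"
    by (rule partial_cong_open[OF open_S x])
      (simp add: V3_equation D3_beta_diff power2_eq_square)
  then show ?thesis by (simp add: partial_rules diff)
qed

text \<open>Multiply \<open>(V\<^sup>3)'\<close> from the third soliton equation by \<open>(b - d)\<^sup>2\<close> and eliminate it with the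
  derivative of the equation for \<open>V\<^sup>3\<close>.\<close>

lemma mu_equation:
  assumes x: "x \<in> S"
  shows "(\<beta> 1 x - \<beta> 2 x)\<^sup>2 * \<mu> x =
     - ((\<beta> 1 x - \<beta> 2 x) * (D3 (D3 (\<lambda>y. \<beta> 1 y - \<beta> 2 y)) x + D3 (\<beta> 1) x * \<beta> 2 x - \<beta> 1 x * D3 (\<beta> 2) x))
     + (D3 (\<lambda>y. \<beta> 1 y - \<beta> 2 y) x)\<^sup>2 + (\<beta> 1 x - \<beta> 2 x)\<^sup>2 * ((\<beta> 1 x)\<^sup>2 + (\<beta> 2 x)\<^sup>2)"
  using V3_equation[OF x] lam_equation[OF x] V3_equation_derivative[OF x] soliton_equations(3)[OF x]
  unfolding D3_beta_diff[OF x] by algebra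

section \<open>The quotient of \<open>f1\<close> and \<open>f2\<close>, and the third component as a
  function of one variable\<close>

text \<open>The logarithmic derivative of a quotient is the difference of the logarithmic
  derivatives, so the derivative vanishes exactly where \<open>\<beta> 1\<close> and
  \<open>\<beta> 2\<close> agree.\<close>

lemma partial_quotient:
  assumes "x \<in> S"
  shows "partial i (\<lambda>y. f1 y / f2 y) x = of_bool (i = 3) * ((\<beta> 1 x - \<beta> 2 x) * (f1 x / f2 x))"
proof -
  have "partial i (\<lambda>y. a 1 y / a 2 y) x
      = of_bool (i = 3) * ((\<beta> 1 x - \<beta> 2 x) * (a 1 x / a 2 x))"
    using a_nonzero[OF assms, of 2]
    by (simp add: partial_rules a_diff[OF assms] partial_a[OF assms] field_simps power2_eq_square)
  then show ?thesis by (simp add: a_def)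
qed

lemma quotient_constant_on_iff:
  assumes "open T" "convex T" "T \<subseteq> S"
  shows "(\<lambda>y. f1 y / f2 y) constant_on T \<longleftrightarrow> (\<forall>x\<in>T. \<beta> 1 x = \<beta> 2 x)"
proof
  assume c: "(\<lambda>y. f1 y / f2 y) constant_on T"
  show "\<forall>x\<in>T. \<beta> 1 x = \<beta> 2 x"
  proof
    fix x assume "x \<in> T"
    then show "\<beta> 1 x = \<beta> 2 x"
      using constant_on_partial_eq_0[OF assms(1) c, of x 3] partial_quotient[of x 3] assms(3) f_nonzero
      by auto
  qed
next
  assume "\<forall>x\<in>T. \<beta> 1 x = \<beta> 2 x"
  then show "(\<lambda>y. f1 y / f2 y) constant_on T"
    using assms(3) f_nonzero f_smooth
    by (intro constant_on_if_partials_0 assms(1,2) differentiable_divide)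
      (auto simp: partial_quotient intro: smooth_differentiable)
qed

lemma V3_function_of_x3:
  "\<exists>F. \<forall>x\<in>S. Vc 3 x = F (x $ 3) \<and> (F has_real_derivative D3 (Vc 3) x) (at (x $ 3))"
proof (cases "S = {}")
  case False
  then obtain p where p: "p \<in> S" by blast
  \<comment> \<open>The line in direction 3 through \<open>p\<close>, parametrised so that
    \<open>q t\<close> has third coordinate \<open>t\<close>; the witness is \<open>Vc 3\<close>
    along it.\<close>
  define q where "q t = p + (t - p $ 3) *\<^sub>R axis 3 1" for t
  show ?thesis
  proof (intro exI[of _ "\<lambda>t. Vc 3 (q t)"] ballI conjI)
    fix x assume x: "x \<in> S"
    have q: "q (x $ 3) \<in> S" "q (x $ 3) $ 3 = x $ 3"
      using p x by (auto simp: q_def box3_def axis_def)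
    show "Vc 3 x = Vc 3 (q (x $ 3))"
      using depends_only_on_x3D[OF V_x3[rule_format] x q(1)] q(2) by simp
    \<comment> \<open>Shifting the parameter by \<open>x $ 3\<close> gives the line through
      \<open>q (x $ 3)\<close> at time 0.\<close>
    have "((\<lambda>t. Vc 3 (q (t + x $ 3))) has_real_derivative D3 (Vc 3) (q (x $ 3))) (at 0)"
      using partial_eq_line_derivative[OF Vc_diff[OF q(1)], of 3 3]
      by (simp add: q_def algebra_simps)
    moreover have "D3 (Vc 3) (q (x $ 3)) = D3 (Vc 3) x"
      using depends_only_on_x3D[OF depends_only_on_x3_D3[OF open_S V_x3[rule_format] Vc_diff] q(1) x] q(2)
      by simp
    ultimately show "((\<lambda>t. Vc 3 (q t)) has_real_derivative D3 (Vc 3) x) (at (x $ 3))"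
      using DERIV_shift[of "\<lambda>t. Vc 3 (q t)" "D3 (Vc 3) x" 0 "x $ 3"] by simp
  qed
qed simp

end

theorem theorem3p12:
  fixes I1 I2 I3 :: "real set"
    and f1 f2 lam \<mu> b d :: "real^3 \<Rightarrow> real"
    and Vc :: "3 \<Rightarrow> real^3 \<Rightarrow> real"
    and V :: "real^3 \<Rightarrow> real^3"
    and nabla :: "(real^3 \<Rightarrow> real^3) \<Rightarrow> (real^3 \<Rightarrow> real^3) \<Rightarrow> real^3 \<Rightarrow> real^3"
  assumes intervals: "open_interval I1" "open_interval I2" "open_interval I3"
    and f_smooth: "smooth (box3 I1 I2 I3) f1" "smooth (box3 I1 I2 I3) f2"
    and f_nonzero: "\<forall>x\<in>box3 I1 I2 I3. f1 x \<noteq> 0 \<and> f2 x \<noteq> 0"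
    and soliton: "almost_eta_ricci_soliton (box3 I1 I2 I3) (warped_metric f1 f2) nabla
                    (warped_frame f1 f2) dx3 V lam \<mu>"
    and V: "\<forall>x\<in>box3 I1 I2 I3. V x = (\<Sum>k\<in>UNIV. Vc k x *\<^sub>R warped_frame f1 f2 k x)"
    and f_x3: "depends_only_on_x3 (box3 I1 I2 I3) f1" "depends_only_on_x3 (box3 I1 I2 I3) f2"
    and V_x3: "\<forall>k. depends_only_on_x3 (box3 I1 I2 I3) (Vc k)"
    and b: "b = (\<lambda>x. D3 f1 x / f1 x)"
    and d: "d = (\<lambda>x. D3 f2 x / f2 x)"
  shows
    "(\<exists>c1 c2. \<forall>x\<in>box3 I1 I2 I3.
        Vc 1 x = c1 / f1 x \<and> Vc 2 x = c2 / f2 x \<and>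
        (b x - d x) * Vc 3 x = D3 (\<lambda>y. b y - d y) x - ((b x)\<^sup>2 - (d x)\<^sup>2) \<and>
        (b x - d x) * lam x = D3 b x * d x - b x * D3 d x \<and>
        (b x - d x)\<^sup>2 * \<mu> x =
          - ((b x - d x) * (D3 (D3 (\<lambda>y. b y - d y)) x + D3 b x * d x - b x * D3 d x))
          + (D3 (\<lambda>y. b y - d y) x)\<^sup>2 + (b x - d x)\<^sup>2 * ((b x)\<^sup>2 + (d x)\<^sup>2)) \<and>
     (\<forall>J3. open_interval J3 \<and> J3 \<subseteq> I3 \<longrightarrow>
        ((\<forall>x\<in>box3 I1 I2 J3. D3 (\<lambda>y. f1 y / f2 y) x \<noteq> 0) \<longleftrightarrow>
           (\<forall>x\<in>box3 I1 I2 J3. b x \<noteq> d x)) \<and>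
        ((\<forall>x\<in>box3 I1 I2 J3. D3 (\<lambda>y. f1 y / f2 y) x \<noteq> 0) \<longrightarrow>
          (\<exists>c1 c2. \<forall>x\<in>box3 I1 I2 J3.
             Vc 1 x = c1 / f1 x \<and> Vc 2 x = c2 / f2 x \<and>
             Vc 3 x = D3 (\<lambda>y. b y - d y) x / (b x - d x) - (b x + d x) \<and>
             lam x = (D3 b x * d x - b x * D3 d x) / (b x - d x) \<and>
             \<mu> x = - ((D3 (D3 (\<lambda>y. b y - d y)) x + D3 b x * d x - b x * D3 d x) / (b x - d x))
                   + (D3 (\<lambda>y. b y - d y) x / (b x - d x))\<^sup>2 + (b x)\<^sup>2 + (d x)\<^sup>2) \<and>
          (\<forall>J. open_interval J \<and> J \<subseteq> J3 \<and> f1 constant_on box3 I1 I2 J \<longrightarrow>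
             (\<forall>x\<in>box3 I1 I2 J. D3 f2 x \<noteq> 0) \<and>
             (\<exists>c1 c2. \<forall>x\<in>box3 I1 I2 J.
                Vc 1 x = c1 \<and> Vc 2 x = c2 / f2 x \<and>
                Vc 3 x = (D3 d x - (d x)\<^sup>2) / d x \<and> lam x = 0 \<and>
                \<mu> x = - (D3 (D3 d) x / d x) + (D3 d x / d x)\<^sup>2 + (d x)\<^sup>2)) \<and>
          (\<forall>J. open_interval J \<and> J \<subseteq> J3 \<and> f2 constant_on box3 I1 I2 J \<longrightarrow>
             (\<forall>x\<in>box3 I1 I2 J. D3 f1 x \<noteq> 0) \<and>
             (\<exists>c1 c2. \<forall>x\<in>box3 I1 I2 J.
                Vc 1 x = c1 / f1 x \<and> Vc 2 x = c2 \<and>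
                Vc 3 x = (D3 b x - (b x)\<^sup>2) / b x \<and> lam x = 0 \<and>
                \<mu> x = - (D3 (D3 b) x / b x) + (D3 b x / b x)\<^sup>2 + (b x)\<^sup>2)))) \<and>
     (\<forall>J3. open_interval J3 \<and> J3 \<subseteq> I3 \<longrightarrow>
        ((\<lambda>y. f1 y / f2 y) constant_on box3 I1 I2 J3 \<longleftrightarrow> (\<forall>x\<in>box3 I1 I2 J3. b x = d x)) \<and>
        ((\<lambda>y. f1 y / f2 y) constant_on box3 I1 I2 J3 \<longrightarrow>
          (\<exists>c1 c2. \<forall>x\<in>box3 I1 I2 J3.
             Vc 1 x = c1 / f1 x \<and> Vc 2 x = c2 / f2 x \<and>
             b x * Vc 3 x = D3 b x - 2 * (b x)\<^sup>2 + lam x \<and>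
             D3 (Vc 3) x = - 2 * (D3 b x - (b x)\<^sup>2) - (lam x + \<mu> x)) \<and>
          (\<forall>J. open_interval J \<and> J \<subseteq> J3 \<and> (\<forall>x\<in>box3 I1 I2 J. D3 f1 x \<noteq> 0) \<longrightarrow>
             (\<forall>x\<in>box3 I1 I2 J. D3 f2 x \<noteq> 0) \<and>
             (\<exists>c1 c2. \<forall>x\<in>box3 I1 I2 J.
                Vc 1 x = c1 / f1 x \<and> Vc 2 x = c2 / f2 x \<and>
                Vc 3 x = (D3 b x - 2 * (b x)\<^sup>2 + lam x) / b x \<and>
                lam x = - D3 (\<lambda>y. (D3 b y + lam y) / b y) x + 2 * (b x)\<^sup>2 - \<mu> x)) \<and>
          (\<forall>J. open_interval J \<and> J \<subseteq> J3 \<and>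
               f1 constant_on box3 I1 I2 J \<and> f2 constant_on box3 I1 I2 J \<longrightarrow>
             (\<exists>c1 c2. \<exists>F :: real \<Rightarrow> real. \<forall>x\<in>box3 I1 I2 J.
                Vc 1 x = c1 \<and> Vc 2 x = c2 \<and> Vc 3 x = F (x $ 3) \<and> lam x = 0 \<and>
                (F has_real_derivative - \<mu> x) (at (x $ 3))))))"
proof -
  let ?S = "box3 I1 I2 I3"
  interpret warped_soliton I1 I2 I3 f1 f2 lam \<mu> Vc V nabla
    by unfold_locales (fact assms)+
  \<comment> \<open>Equality of total functions, so the names can be exchanged under
    \<open>D3\<close> too.\<close>
  have b_eq: "b = \<beta> 1" and d_eq: "d = \<beta> 2"
    by (simp_all add: b d \<beta>_def a_def fun_eq_iff)
  note eqs = soliton_equations(1-3)[folded b_eq d_eq]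
  obtain c1 where c1: "\<And>x. x \<in> ?S \<Longrightarrow> Vc 1 x = c1 / f1 x"
    using V_constants[of 1] by (auto simp: a_def)
  obtain c2 where c2: "\<And>x. x \<in> ?S \<Longrightarrow> Vc 2 x = c2 / f2 x"
    using V_constants[of 2] by (auto simp: a_def)
  have box: "open (box3 I1 I2 J)" "convex (box3 I1 I2 J)" "box3 I1 I2 J \<subseteq> ?S"
    if "open_interval J" "J \<subseteq> I3" for J
    using that intervals by (auto simp: open_interval_def open_box3 convex_box3 box3_mono)
  have in_S: "x \<in> ?S" if "x \<in> box3 I1 I2 J" "J \<subseteq> I3" for x J
    using that by (auto simp: box3_def)
  have D3_quotient: "D3 (\<lambda>y. f1 y / f2 y) x \<noteq> 0 \<longleftrightarrow> b x \<noteq> d x" if "x \<in> ?S" for x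
    using that f_nonzero by (simp add: partial_quotient b_eq d_eq)
  have solved:
    "Vc 3 x = D3 (\<lambda>y. b y - d y) x / (b x - d x) - (b x + d x)"
    "lam x = (D3 b x * d x - b x * D3 d x) / (b x - d x)"
    "\<mu> x = - ((D3 (D3 (\<lambda>y. b y - d y)) x + D3 b x * d x - b x * D3 d x) / (b x - d x))
        + (D3 (\<lambda>y. b y - d y) x / (b x - d x))\<^sup>2 + (b x)\<^sup>2 + (d x)\<^sup>2"
    if x: "x \<in> ?S" and ne: "b x \<noteq> d x" for x
  proof -
    have u: "b x - d x \<noteq> 0" using ne by simp
    have "Vc 3 x = (D3 (\<lambda>y. b y - d y) x - ((b x)\<^sup>2 - (d x)\<^sup>2)) / (b x - d x)"
      using V3_equation[OF x] u by (simp add: b_eq d_eq nonzero_eq_divide_eq mult.commute)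
    also have "(b x)\<^sup>2 - (d x)\<^sup>2 = (b x + d x) * (b x - d x)"
      by (simp add: power2_eq_square algebra_simps)
    finally show "Vc 3 x = D3 (\<lambda>y. b y - d y) x / (b x - d x) - (b x + d x)"
      using u by (simp add: diff_divide_distrib)
    show "lam x = (D3 b x * d x - b x * D3 d x) / (b x - d x)"
      using lam_equation[OF x] u by (simp add: b_eq d_eq nonzero_eq_divide_eq mult.commute)
    \<comment> \<open>Division of \<open>mu_equation\<close> by the square of
      \<open>b x - d x\<close>, stated for arbitrary reals so that the derivative terms stay
      opaque.\<close>
    have "m = - (p / u) + (q / u)\<^sup>2 + r" if "u \<noteq> 0" "u\<^sup>2 * m = - (u * p) + q\<^sup>2 + u\<^sup>2 * r"
      for m p q r u :: real
    proof -
      have "u\<^sup>2 * (- (p / u) + (q / u)\<^sup>2 + r) = - (u * p) + q\<^sup>2 + u\<^sup>2 * r"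
        using that(1) by (simp add: field_simps power2_eq_square)
      then have "u\<^sup>2 * m = u\<^sup>2 * (- (p / u) + (q / u)\<^sup>2 + r)"
        using that(2) by simp
      then show ?thesis using that(1) by simp
    qed
    from this[OF u mu_equation[OF x, folded b_eq d_eq]]
    show "\<mu> x = - ((D3 (D3 (\<lambda>y. b y - d y)) x + D3 b x * d x - b x * D3 d x) / (b x - d x))
        + (D3 (\<lambda>y. b y - d y) x / (b x - d x))\<^sup>2 + (b x)\<^sup>2 + (d x)\<^sup>2" by simp
  qed
  have const: "\<beta> k x = 0 \<and> D3 (\<beta> k) x = 0 \<and> D3 (D3 (\<beta> k)) x = 0"
    if "open_interval J" "J \<subseteq> I3" "a k constant_on box3 I1 I2 J" "x \<in> box3 I1 I2 J" for J k x
  proof -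
    note op = box(1)[OF that(1,2)]
    \<comment> \<open>Each function is constant on the open box over \<open>J\<close>, so its
      derivative vanishes there and is again constant.\<close>
    have 0: "\<beta> k y = 0" if "y \<in> box3 I1 I2 J" for y
      using constant_on_partial_eq_0[OF op \<open>a k constant_on _\<close> that] by (simp add: \<beta>_def)
    then have 1: "D3 (\<beta> k) y = 0" if "y \<in> box3 I1 I2 J" for y
      using that by (intro constant_on_partial_eq_0[OF op]) (auto simp: constant_on_def)
    then have "D3 (D3 (\<beta> k)) x = 0"
      using that by (intro constant_on_partial_eq_0[OF op]) (auto simp: constant_on_def)
    with 0 1 that show ?thesis by blast
  qed
  have const1: "b x = 0 \<and> D3 b x = 0 \<and> D3 (D3 b) x = 0"
    if "open_interval J" "J \<subseteq> I3" "f1 constant_on box3 I1 I2 J" "x \<in> box3 I1 I2 J" for J x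
    using const[of J 1] that by (simp add: a_def b_eq)
  have const2: "d x = 0 \<and> D3 d x = 0 \<and> D3 (D3 d) x = 0"
    if "open_interval J" "J \<subseteq> I3" "f2 constant_on box3 I1 I2 J" "x \<in> box3 I1 I2 J" for J x
    using const[of J 2] that by (simp add: a_def d_eq)
  \<comment> \<open>Where \<open>f1\<close> is constant, \<open>c1 / f1\<close> is a constant too;
    it generally differs from \<open>c1\<close>.\<close>
  have V1_const: "\<exists>c. \<forall>x\<in>box3 I1 I2 J. Vc 1 x = c" if "J \<subseteq> I3" "f1 constant_on box3 I1 I2 J" for J
    using that c1 in_S[OF _ that(1)] by (auto simp: constant_on_def)
  have V2_const: "\<exists>c. \<forall>x\<in>box3 I1 I2 J. Vc 2 x = c" if "J \<subseteq> I3" "f2 constant_on box3 I1 I2 J" for J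
    using that c2 in_S[OF _ that(1)] by (auto simp: constant_on_def)

  \<comment> \<open>Identities on the whole box\<close>
  have main: "\<forall>x\<in>?S.
        Vc 1 x = c1 / f1 x \<and> Vc 2 x = c2 / f2 x \<and>
        (b x - d x) * Vc 3 x = D3 (\<lambda>y. b y - d y) x - ((b x)\<^sup>2 - (d x)\<^sup>2) \<and>
        (b x - d x) * lam x = D3 b x * d x - b x * D3 d x \<and>
        (b x - d x)\<^sup>2 * \<mu> x =
          - ((b x - d x) * (D3 (D3 (\<lambda>y. b y - d y)) x + D3 b x * d x - b x * D3 d x))
          + (D3 (\<lambda>y. b y - d y) x)\<^sup>2 + (b x - d x)\<^sup>2 * ((b x)\<^sup>2 + (d x)\<^sup>2)"
    unfolding b_eq d_eq by (intro ballI conjI c1 c2 V3_equation lam_equation mu_equation)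

  \<comment> \<open>Different slopes with one constant coefficient\<close>
  have case_i1: "(\<forall>x\<in>box3 I1 I2 J. D3 f2 x \<noteq> 0) \<and>
      (\<exists>c1 c2. \<forall>x\<in>box3 I1 I2 J.
         Vc 1 x = c1 \<and> Vc 2 x = c2 / f2 x \<and>
         Vc 3 x = (D3 d x - (d x)\<^sup>2) / d x \<and> lam x = 0 \<and>
         \<mu> x = - (D3 (D3 d) x / d x) + (D3 d x / d x)\<^sup>2 + (d x)\<^sup>2)"
    if J: "open_interval J" "J \<subseteq> I3" and c: "f1 constant_on box3 I1 I2 J"
      and J3: "J \<subseteq> J3" "\<forall>x\<in>box3 I1 I2 J3. D3 (\<lambda>y. f1 y / f2 y) x \<noteq> 0" for J J3
  proof -
    have ne: "b x \<noteq> d x" if "x \<in> box3 I1 I2 J" for x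
      using D3_quotient[OF in_S[OF that J(2)]] that box3_mono[OF J3(1)] J3(2) by blast
    \<comment> \<open>Constant \<open>f1\<close> forces \<open>b x = 0\<close>, so
      \<open>b x \<noteq> d x\<close> says that \<open>d x\<close> is nonzero; this also gives the
      claim on \<open>D3 f2\<close>.\<close>
    have d0: "d x \<noteq> 0" if "x \<in> box3 I1 I2 J" for x
      using ne[OF that] const1[OF J c that] by simp
    obtain k where k: "\<And>x. x \<in> box3 I1 I2 J \<Longrightarrow> Vc 1 x = k"
      using V1_const[OF J(2) c] by blast
    \<comment> \<open>With \<open>b\<close> and its derivatives zero, the minus signs of numerators
      and denominators cancel in the general formulas.\<close>
    have "Vc 3 x = (D3 d x - (d x)\<^sup>2) / d x \<and> lam x = 0 \<and>
         \<mu> x = - (D3 (D3 d) x / d x) + (D3 d x / d x)\<^sup>2 + (d x)\<^sup>2"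
      if x: "x \<in> box3 I1 I2 J" for x
      using solved[OF in_S[OF x J(2)] ne[OF x]] const1[OF J c x] d0[OF x]
        D3_beta_diff[OF in_S[OF x J(2)], folded b_eq d_eq]
      by (simp add: diff_divide_distrib power2_eq_square)
    then show ?thesis
      using d0 k c2 in_S[OF _ J(2)] by (intro conjI exI[of _ k] exI[of _ c2]) (auto simp: d)
  qed
  have case_i2: "(\<forall>x\<in>box3 I1 I2 J. D3 f1 x \<noteq> 0) \<and>
      (\<exists>c1 c2. \<forall>x\<in>box3 I1 I2 J.
         Vc 1 x = c1 / f1 x \<and> Vc 2 x = c2 \<and>
         Vc 3 x = (D3 b x - (b x)\<^sup>2) / b x \<and> lam x = 0 \<and>
         \<mu> x = - (D3 (D3 b) x / b x) + (D3 b x / b x)\<^sup>2 + (b x)\<^sup>2)"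
    if J: "open_interval J" "J \<subseteq> I3" and c: "f2 constant_on box3 I1 I2 J"
      and J3: "J \<subseteq> J3" "\<forall>x\<in>box3 I1 I2 J3. D3 (\<lambda>y. f1 y / f2 y) x \<noteq> 0" for J J3
  proof -
    have ne: "b x \<noteq> d x" if "x \<in> box3 I1 I2 J" for x
      using D3_quotient[OF in_S[OF that J(2)]] that box3_mono[OF J3(1)] J3(2) by blast
    have b0: "b x \<noteq> 0" if "x \<in> box3 I1 I2 J" for x
      using ne[OF that] const2[OF J c that] by simp
    obtain k where k: "\<And>x. x \<in> box3 I1 I2 J \<Longrightarrow> Vc 2 x = k"
      using V2_const[OF J(2) c] by blast
    have "Vc 3 x = (D3 b x - (b x)\<^sup>2) / b x \<and> lam x = 0 \<and>
         \<mu> x = - (D3 (D3 b) x / b x) + (D3 b x / b x)\<^sup>2 + (b x)\<^sup>2"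
      if x: "x \<in> box3 I1 I2 J" for x
      using solved[OF in_S[OF x J(2)] ne[OF x]] const2[OF J c x] b0[OF x]
        D3_beta_diff[OF in_S[OF x J(2)], folded b_eq d_eq]
      by (simp add: diff_divide_distrib power2_eq_square)
    then show ?thesis
      using b0 k c1 in_S[OF _ J(2)] by (intro conjI exI[of _ c1] exI[of _ k]) (auto simp: b)
  qed

  \<comment> \<open>Equal slopes\<close>
  have equal_slopes: "D3 d x = D3 b x"
    if "open_interval J" "J \<subseteq> I3" "\<forall>x\<in>box3 I1 I2 J. b x = d x" "x \<in> box3 I1 I2 J" for J x
    using that by (intro partial_cong_open[OF box(1)[OF that(1,2)]]) auto
  \<comment> \<open>When \<open>b\<close> and \<open>d\<close> agree, the first two soliton
    equations coincide, so \<open>lam\<close> remains in the formula for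
    \<open>Vc 3\<close>.\<close>
  have case_ii: "Vc 1 x = c1 / f1 x \<and> Vc 2 x = c2 / f2 x \<and>
      b x * Vc 3 x = D3 b x - 2 * (b x)\<^sup>2 + lam x \<and>
      D3 (Vc 3) x = - 2 * (D3 b x - (b x)\<^sup>2) - (lam x + \<mu> x)"
    if J: "open_interval J" "J \<subseteq> I3" and eq: "\<forall>x\<in>box3 I1 I2 J. b x = d x"
      and x: "x \<in> box3 I1 I2 J" for J x
    using c1 c2 in_S[OF x J(2)] eqs[OF in_S[OF x J(2)]] eq[rule_format, OF x] equal_slopes[OF J eq x]
    by (simp add: power2_eq_square algebra_simps)
  have case_ii1: "(\<forall>x\<in>box3 I1 I2 J. D3 f2 x \<noteq> 0) \<and>
      (\<exists>c1 c2. \<forall>x\<in>box3 I1 I2 J.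
         Vc 1 x = c1 / f1 x \<and> Vc 2 x = c2 / f2 x \<and>
         Vc 3 x = (D3 b x - 2 * (b x)\<^sup>2 + lam x) / b x \<and>
         lam x = - D3 (\<lambda>y. (D3 b y + lam y) / b y) x + 2 * (b x)\<^sup>2 - \<mu> x)"
    if J: "open_interval J" "J \<subseteq> I3" and eq: "\<forall>x\<in>box3 I1 I2 J. b x = d x"
      and f1': "\<forall>x\<in>box3 I1 I2 J. D3 f1 x \<noteq> 0" for J
  proof -
    note ii = case_ii[OF J eq]
    have b0: "b x \<noteq> 0" if "x \<in> box3 I1 I2 J" for x
      using f1' that f_nonzero in_S[OF that J(2)] by (simp add: b)
    have V3: "Vc 3 x = (D3 b x - 2 * (b x)\<^sup>2 + lam x) / b x" if "x \<in> box3 I1 I2 J" for x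
      using ii[OF that] b0[OF that] by (simp add: nonzero_eq_divide_eq mult.commute)
    have lam: "lam x = - D3 (\<lambda>y. (D3 b y + lam y) / b y) x + 2 * (b x)\<^sup>2 - \<mu> x"
      if x: "x \<in> box3 I1 I2 J" for x
    proof -
      \<comment> \<open>The quotient is \<open>Vc 3 y + 2 * b y\<close>, so only \<open>Vc 3\<close>
        and \<open>b\<close> are differentiated; the formula for \<open>D3 (Vc 3)\<close> then
        cancels the term \<open>2 * D3 b x\<close>.\<close>
      have "D3 (\<lambda>y. (D3 b y + lam y) / b y) x = D3 (\<lambda>y. Vc 3 y + 2 * b y) x"
      proof (rule partial_cong_open[OF box(1)[OF J] x])
        fix y assume "y \<in> box3 I1 I2 J"
        then show "(D3 b y + lam y) / b y = Vc 3 y + 2 * b y"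
          using ii[of y] b0[of y] by (simp add: field_simps power2_eq_square)
      qed
      also have "\<dots> = D3 (Vc 3) x + 2 * D3 b x"
        using in_S[OF x J(2)] by (simp add: partial_rules b_eq beta_diff Vc_diff)
      finally show ?thesis using ii[OF x] by simp
    qed
    have "D3 f2 x \<noteq> 0" if "x \<in> box3 I1 I2 J" for x
      using b0[OF that] eq that by (auto simp: d)
    then show ?thesis
      using ii V3 lam by (intro conjI exI[of _ c1] exI[of _ c2]) auto
  qed
  have case_ii2: "\<exists>c1 c2. \<exists>F :: real \<Rightarrow> real. \<forall>x\<in>box3 I1 I2 J.
       Vc 1 x = c1 \<and> Vc 2 x = c2 \<and> Vc 3 x = F (x $ 3) \<and> lam x = 0 \<and>
       (F has_real_derivative - \<mu> x) (at (x $ 3))"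
    if J: "open_interval J" "J \<subseteq> I3"
      and c: "f1 constant_on box3 I1 I2 J" "f2 constant_on box3 I1 I2 J" for J
  proof -
    obtain k1 k2 where "\<forall>x\<in>box3 I1 I2 J. Vc 1 x = k1" "\<forall>x\<in>box3 I1 I2 J. Vc 2 x = k2"
      using V1_const[OF J(2) c(1)] V2_const[OF J(2) c(2)] by blast
    moreover obtain F where F: "\<And>x. x \<in> ?S \<Longrightarrow>
        Vc 3 x = F (x $ 3) \<and> (F has_real_derivative D3 (Vc 3) x) (at (x $ 3))"
      using V3_function_of_x3 by blast
    \<comment> \<open>With \<open>b\<close>, \<open>d\<close> and their derivatives zero, the first
      and third soliton equations reduce to these two.\<close>
    moreover have "lam x = 0 \<and> D3 (Vc 3) x = - \<mu> x" if x: "x \<in> box3 I1 I2 J" for x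
      using eqs[OF in_S[OF x J(2)]] const1[OF J c(1) x] const2[OF J c(2) x] by simp
    ultimately show ?thesis
      using in_S[OF _ J(2)] by (intro exI[of _ k1] exI[of _ k2] exI[of _ F]) metis
  qed

  \<comment> \<open>Equivalent forms of the two cases and assembly\<close>
  have part_i: "((\<forall>x\<in>box3 I1 I2 J3. D3 (\<lambda>y. f1 y / f2 y) x \<noteq> 0) \<longleftrightarrow>
      (\<forall>x\<in>box3 I1 I2 J3. b x \<noteq> d x))" if J3: "open_interval J3" "J3 \<subseteq> I3" for J3
    using D3_quotient in_S[OF _ J3(2)] by blast
  have part_ii: "(\<lambda>y. f1 y / f2 y) constant_on box3 I1 I2 J3 \<longleftrightarrow> (\<forall>x\<in>box3 I1 I2 J3. b x = d x)"
    if J3: "open_interval J3" "J3 \<subseteq> I3" for J3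
    unfolding b_eq d_eq by (rule quotient_constant_on_iff[OF box[OF J3]])
  have case_i: "\<exists>c1 c2. \<forall>x\<in>box3 I1 I2 J3.
       Vc 1 x = c1 / f1 x \<and> Vc 2 x = c2 / f2 x \<and>
       Vc 3 x = D3 (\<lambda>y. b y - d y) x / (b x - d x) - (b x + d x) \<and>
       lam x = (D3 b x * d x - b x * D3 d x) / (b x - d x) \<and>
       \<mu> x = - ((D3 (D3 (\<lambda>y. b y - d y)) x + D3 b x * d x - b x * D3 d x) / (b x - d x))
             + (D3 (\<lambda>y. b y - d y) x / (b x - d x))\<^sup>2 + (b x)\<^sup>2 + (d x)\<^sup>2"
    if "J3 \<subseteq> I3" "\<forall>x\<in>box3 I1 I2 J3. D3 (\<lambda>y. f1 y / f2 y) x \<noteq> 0" for J3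
  proof -
    have "b x \<noteq> d x" if "x \<in> box3 I1 I2 J3" for x
      using D3_quotient[OF in_S[OF that \<open>J3 \<subseteq> I3\<close>]] that \<open>\<forall>x\<in>box3 I1 I2 J3. _ x\<close> by blast
    then show ?thesis
      by (intro exI[of _ c1] exI[of _ c2] ballI conjI c1 c2 solved in_S[OF _ that(1)])
  qed
  have eq_slopes: "\<forall>x\<in>box3 I1 I2 J. b x = d x"
    if "open_interval J3" "J3 \<subseteq> I3" "J \<subseteq> J3" "(\<lambda>y. f1 y / f2 y) constant_on box3 I1 I2 J3" for J J3
    using part_ii[OF that(1,2)] that(4) box3_mono[OF that(3), of I1 I2] by blast
  show ?thesis
    \<comment> \<open>Splitting separates each nonvanishing claim from its formulas, which is why
      some of the case facts are used once per conjunct.\<close>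
    apply (intro conjI allI impI; (elim conjE)?)
    subgoal using main by blast
    subgoal by (rule part_i)
    subgoal by (rule case_i)
    subgoal premises p for J3 J
      by (rule case_i1[OF p(4) order.trans[OF p(5,3)] p(6,5,1), THEN conjunct1])
    subgoal premises p for J3 J
      by (rule case_i1[OF p(4) order.trans[OF p(5,3)] p(6,5,1), THEN conjunct2])
    subgoal premises p for J3 J
      by (rule case_i2[OF p(4) order.trans[OF p(5,3)] p(6,5,1), THEN conjunct1])
    subgoal premises p for J3 J
      by (rule case_i2[OF p(4) order.trans[OF p(5,3)] p(6,5,1), THEN conjunct2])
    subgoal by (rule part_ii)
    subgoal premises p for J3
      using case_ii[OF p(2,3) eq_slopes[OF p(2,3) order.refl p(1)]] by blast
    subgoal premises p for J3 J
      by (rule case_ii1[OF p(4) order.trans[OF p(5,3)] eq_slopes[OF p(2,3,5,1)] p(6), THEN conjunct1])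
    subgoal premises p for J3 J
      by (rule case_ii1[OF p(4) order.trans[OF p(5,3)] eq_slopes[OF p(2,3,5,1)] p(6), THEN conjunct2])
    subgoal premises p for J3 J
      by (rule case_ii2[OF p(4) order.trans[OF p(5,3)] p(6,7)])
    done
qed

end
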